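(* Let $G$ be a connected finite simple graph and $K$ a field. Then the total simplicial complex $\Delta_T(G)$ is Buchsbaum over $K$.
   Context: Total simplicial complex: for a finite simple graph $G$ with vertex set $[m]$ and edge set $E(G)$, the set of total indices $\Upsilon_T(G)$ is the collection of subsets of $[m]\cup E(G)$ consisting of the sets $\{p,q,r\}$ such that (i) $p,q,r$ are adjacent vertices in $G$; or (ii) $p,q,r$ are adjacent edges in $G$; or (iii) $p$ and $q$ are adjacent vertices and $r$ is an edge incident to $p$ or $q$; or (iv) $p$ and $q$ are adjacent edges and $r$ is a vertex incident to $p$ or $q$; together with the singletons $\{p\}$ for each isolated vertex $p$ of $G$. The total simplicial complex $\Delta_T(G)$ is the simplicial complex on vertex set $[m]\cup E(G)$ generated by the sets in $\Upsilon_T(G)$. A simplicial complex $\Delta$ is Cohen–Macaulay over $K$ if its Stanley–Reisner ring $K[\Delta]$ is Cohen–Macaulay; it is Buchsbaum ($CM_1$) over $K$ if $\Delta$ is pure and $\mathrm{link}_\Delta(\sigma)=\{\tau\in\Delta:\tau\cap\sigma=\emptyset,\ \tau\cup\sigma\in\Delta\}$ is Cohen–Macaulay over $K$ for every nonempty face $\sigma\in\Delta$. *)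

theory Defs
  imports
    "HOL-Algebra.QuotRing"
    "HOL-Algebra.Ring_Divisibility"
    "HOL-Library.Poly_Mapping"
    "HOL-Library.Extended_Nat"
begin

section \<open>Cohen-Macaulay rings\<close>

text \<open>
  A regular sequence \<open>x\<^sub>1, \<dots>, x\<^sub>n\<close>: the ideal it generates is proper, and \<open>x\<^sub>i\<close> is a
  nonzerodivisor on \<open>R / (x\<^sub>1, \<dots>, x\<^sub>i\<^sub>-\<^sub>1)\<close>, which is written out here in \<open>R\<close> itself.
\<close>

definition regular_sequence :: "('a, 'b) ring_scheme \<Rightarrow> 'a list \<Rightarrow> bool" where
  "regular_sequence R xs \<longleftrightarrow>
     set xs \<subseteq> carrier R \<and>
     Idl\<^bsub>R\<^esub> (set xs) \<noteq> carrier R \<and>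
     (\<forall>i < length xs. \<forall>a \<in> carrier R.
        xs ! i \<otimes>\<^bsub>R\<^esub> a \<in> Idl\<^bsub>R\<^esub> (set (take i xs)) \<longrightarrow> a \<in> Idl\<^bsub>R\<^esub> (set (take i xs)))"

definition ideal_depth :: "('a, 'b) ring_scheme \<Rightarrow> 'a set \<Rightarrow> enat" where
  "ideal_depth R I = (SUP xs \<in> {xs. regular_sequence R xs \<and> set xs \<subseteq> I}. enat (length xs))"

text \<open>
  The height (codimension) of a prime ideal \<open>P\<close>: the supremum of the \<open>n\<close> for which there is a
  chain \<open>Q 0 \<subset> \<dots> \<subset> Q n = P\<close> of prime ideals.
\<close>

definition prime_height :: "('a, 'b) ring_scheme \<Rightarrow> 'a set \<Rightarrow> enat" where
  "prime_height R P =
     (SUP n \<in> {n. \<exists>Q :: nat \<Rightarrow> 'a set.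
                 (\<forall>i \<le> n. primeideal (Q i) R) \<and> (\<forall>i < n. Q i \<subset> Q (Suc i)) \<and> Q n = P}.
        enat n)"

text \<open>
  The definition of Eisenbud (Commutative Algebra with a View Toward Algebraic Geometry,
  Section 18.2), which avoids localizations: a Noetherian commutative ring in which every
  maximal ideal has depth equal to its codimension.
\<close>

definition cohen_macaulay_ring :: "('a, 'b) ring_scheme \<Rightarrow> bool" where
  "cohen_macaulay_ring R \<longleftrightarrow>
     cring R \<and> noetherian_ring R \<and>
     (\<forall>M. maximalideal M R \<longrightarrow> ideal_depth R M = prime_height R M)"


section \<open>Stanley-Reisner rings\<close>

text \<open>
  Polynomials in variables indexed by \<open>'v\<close> are finitely supported maps from exponent vectors
  \<open>'v \<Rightarrow>\<^sub>0 nat\<close> to coefficients; \<open>mpoly_ring W\<close> is the subring \<open>K[x\<^sub>v | v \<in> W]\<close>.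
\<close>

definition mpoly_ring :: "'v set \<Rightarrow> (('v \<Rightarrow>\<^sub>0 nat) \<Rightarrow>\<^sub>0 'k::field) ring" where
  "mpoly_ring W =
     \<lparr>carrier = {p. \<forall>m \<in> Poly_Mapping.keys p. Poly_Mapping.keys m \<subseteq> W}, mult = (*), one = 1, zero = 0, add = (+)\<rparr>"

definition mpoly_var :: "'v \<Rightarrow> (('v \<Rightarrow>\<^sub>0 nat) \<Rightarrow>\<^sub>0 'k::field)" where
  "mpoly_var v = Poly_Mapping.single (Poly_Mapping.single v 1) 1"

text \<open>A complex is the set of its faces, and its vertices are the elements of its faces.\<close>

definition stanley_reisner_ideal :: "'v set set \<Rightarrow> (('v \<Rightarrow>\<^sub>0 nat) \<Rightarrow>\<^sub>0 'k::field) set" where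
  "stanley_reisner_ideal \<Delta> =
     Idl\<^bsub>mpoly_ring (\<Union>\<Delta>)\<^esub> {\<Prod>v\<in>F. mpoly_var v | F. finite F \<and> F \<subseteq> \<Union>\<Delta> \<and> F \<notin> \<Delta>}"

definition stanley_reisner_ring ::
    "'k::field itself \<Rightarrow> 'v set set \<Rightarrow> (('v \<Rightarrow>\<^sub>0 nat) \<Rightarrow>\<^sub>0 'k) set ring" where
  "stanley_reisner_ring _ \<Delta> = mpoly_ring (\<Union>\<Delta>) Quot stanley_reisner_ideal \<Delta>"

definition cohen_macaulay_complex :: "'k::field itself \<Rightarrow> 'v set set \<Rightarrow> bool" where
  "cohen_macaulay_complex K \<Delta> \<longleftrightarrow> cohen_macaulay_ring (stanley_reisner_ring K \<Delta>)"


section \<open>Buchsbaum complexes\<close>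

definition facets :: "'v set set \<Rightarrow> 'v set set" where
  "facets \<Delta> = {F \<in> \<Delta>. \<forall>F' \<in> \<Delta>. F \<subseteq> F' \<longrightarrow> F' = F}"

definition pure_complex :: "'v set set \<Rightarrow> bool" where
  "pure_complex \<Delta> \<longleftrightarrow> (\<forall>F \<in> facets \<Delta>. \<forall>F' \<in> facets \<Delta>. card F = card F')"

definition link :: "'v set set \<Rightarrow> 'v set \<Rightarrow> 'v set set" where
  "link \<Delta> \<sigma> = {\<tau> \<in> \<Delta>. \<tau> \<inter> \<sigma> = {} \<and> \<tau> \<union> \<sigma> \<in> \<Delta>}"

definition buchsbaum :: "'k::field itself \<Rightarrow> 'v set set \<Rightarrow> bool" where
  "buchsbaum K \<Delta> \<longleftrightarrow>
     pure_complex \<Delta> \<and> (\<forall>\<sigma> \<in> \<Delta>. \<sigma> \<noteq> {} \<longrightarrow> cohen_macaulay_complex K (link \<Delta> \<sigma>))"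


section \<open>The total simplicial complex of a graph\<close>

definition simple_graph :: "'a set \<Rightarrow> 'a set set \<Rightarrow> bool" where
  "simple_graph V E \<longleftrightarrow> finite V \<and> (\<forall>e \<in> E. e \<subseteq> V \<and> card e = 2)"

definition connected_graph :: "'a set \<Rightarrow> 'a set set \<Rightarrow> bool" where
  "connected_graph V E \<longleftrightarrow>
     V \<noteq> {} \<and> (\<forall>u \<in> V. \<forall>v \<in> V. (u, v) \<in> {(x, y). {x, y} \<in> E}\<^sup>*)"

definition adjacent_vertices :: "'a set set \<Rightarrow> 'a \<Rightarrow> 'a \<Rightarrow> bool" where
  "adjacent_vertices E p q \<longleftrightarrow> p \<noteq> q \<and> {p, q} \<in> E"

definition adjacent_edges :: "'a set set \<Rightarrow> 'a set \<Rightarrow> 'a set \<Rightarrow> bool" where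
  "adjacent_edges E e f \<longleftrightarrow> e \<in> E \<and> f \<in> E \<and> e \<noteq> f \<and> e \<inter> f \<noteq> {}"

definition isolated_vertex :: "'a set \<Rightarrow> 'a set set \<Rightarrow> 'a \<Rightarrow> bool" where
  "isolated_vertex V E p \<longleftrightarrow> p \<in> V \<and> (\<forall>e \<in> E. p \<notin> e)"

text \<open>
  The disjoint union of vertices and edges is taken in the sum type: \<open>Inl p\<close> is the vertex \<open>p\<close>
  and \<open>Inr e\<close> the edge \<open>e\<close>. Three vertices (or three edges) are called adjacent if they are
  pairwise adjacent.
\<close>

definition total_indices :: "'a set \<Rightarrow> 'a set set \<Rightarrow> ('a + 'a set) set set" where
  "total_indices V E =
     {{Inl p, Inl q, Inl r} | p q r.
        adjacent_vertices E p q \<and> adjacent_vertices E p r \<and> adjacent_vertices E q r}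
   \<union> {{Inr p, Inr q, Inr r} | p q r.
        adjacent_edges E p q \<and> adjacent_edges E p r \<and> adjacent_edges E q r}
   \<union> {{Inl p, Inl q, Inr r} | p q r.
        adjacent_vertices E p q \<and> r \<in> E \<and> (p \<in> r \<or> q \<in> r)}
   \<union> {{Inr p, Inr q, Inl r} | p q r.
        adjacent_edges E p q \<and> r \<in> V \<and> (r \<in> p \<or> r \<in> q)}
   \<union> {{Inl p} | p. isolated_vertex V E p}"

definition total_complex :: "'a set \<Rightarrow> 'a set set \<Rightarrow> ('a + 'a set) set set" where
  "total_complex V E = {F. \<exists>S \<in> total_indices V E. F \<subseteq> S}"

end

(*
  A link in the total complex has dimension at most 1, and the link of a vertex is connected, so
  it suffices that pure complexes of that kind are Cohen-Macaulay. A polynomial vanishes in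
  K[Delta] iff its restrictions to the facets vanish, so most questions can be settled there.

  In any commutative ring a regular sequence in a prime yields a prime chain of the same length,
  so depth <= height. Counting monomials, any d + 1 elements of K[Delta] (dim Delta = d - 1) are
  algebraically dependent, which bounds the height by d. It remains to find a regular sequence of
  length d in each maximal ideal M. By Zariski's lemma M contains f(theta), f nonzero, where theta
  is the sum of all variables, and g(x_w), g nonzero, for an endpoint w of an edge containing all
  variables outside M; the products g(x_u) g(x_w) on the edges {u, w} agree on the vertices and
  glue to an element G of M. On an edge, K[x_u, x_w] = K[theta][x_u], where f(theta) is a constant
  and G has invertible leading coefficient, so f(theta), G is regular there; quotients by f(theta)
  glue again because the graph is connected.
*)

theory Submission
  imports Defs "HOL-Computational_Algebra.Polynomial"
begin

section \<open>Ideals and primes in a commutative ring type\<close>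

text \<open>The definition ranges over all maximal ideals of K[Delta], graded or not, and K may be
  finite or not algebraically closed. Hence linear elements such as theta - c or x_w - c do not
  suffice, and generic linear forms may not exist. The plain sum theta is usable over every field
  because on a vertex or an edge it is part of a coordinate system.

  The second element cannot be g(x_w) itself: on an edge away from w it restricts to g(0), which may
  be 0. The product of g(x_v) over all n vertices fails too, since on an edge it acquires the factor
  g(0)^(n-2). Gluing the edge products removes this factor. The gluing conditions concern the
  monomials shared by two edges: powers of one variable, controlled at the common vertex, and the
  constant term, which even disjoint edges share and which has to be carried along a path.

  The ring in the statement is a quotient with carrier sets. It is treated as an image of the
  polynomial ring on the whole type, so that ideals, primes and regular sequences all live in one
  type and contain a fixed kernel.\<close>

definition is_ideal :: "'r::comm_ring_1 set \<Rightarrow> bool" where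
  "is_ideal J \<longleftrightarrow> 0 \<in> J \<and> (\<forall>x\<in>J. \<forall>y\<in>J. x + y \<in> J) \<and> (\<forall>x\<in>J. \<forall>r. r * x \<in> J)"

definition is_prime :: "'r::comm_ring_1 set \<Rightarrow> bool" where
  "is_prime Q \<longleftrightarrow> is_ideal Q \<and> 1 \<notin> Q \<and> (\<forall>x y. x * y \<in> Q \<longrightarrow> x \<in> Q \<or> y \<in> Q)"

text \<open>Maximality as seen in the residue field: elements outside \<open>M\<close> are
  invertible modulo \<open>M\<close>. In this form it contracts directly along a morphism that is
  onto modulo \<open>M\<close>.\<close>

definition is_maximal :: "'r::comm_ring_1 set \<Rightarrow> bool" where
  "is_maximal M \<longleftrightarrow> is_ideal M \<and> 1 \<notin> M \<and> (\<forall>x. x \<notin> M \<longrightarrow> (\<exists>y. x * y - 1 \<in> M))"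

definition ideal_hull :: "'r::comm_ring_1 set \<Rightarrow> 'r set" where
  "ideal_hull B = \<Inter>{J. is_ideal J \<and> B \<subseteq> J}"

lemma is_idealI:
  "0 \<in> J \<Longrightarrow> (\<And>x y. x \<in> J \<Longrightarrow> y \<in> J \<Longrightarrow> x + y \<in> J) \<Longrightarrow> (\<And>x r. x \<in> J \<Longrightarrow> r * x \<in> J) \<Longrightarrow> is_ideal J"
  by (auto simp: is_ideal_def)

lemma ideal_zero: "is_ideal J \<Longrightarrow> 0 \<in> J"
  and ideal_add: "is_ideal J \<Longrightarrow> x \<in> J \<Longrightarrow> y \<in> J \<Longrightarrow> x + y \<in> J"
  and ideal_mult: "is_ideal J \<Longrightarrow> x \<in> J \<Longrightarrow> r * x \<in> J"
  by (auto simp: is_ideal_def)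

lemma ideal_mult_right: "is_ideal J \<Longrightarrow> x \<in> J \<Longrightarrow> x * r \<in> J"
  by (metis ideal_mult mult.commute)

lemma ideal_uminus: "is_ideal J \<Longrightarrow> x \<in> J \<Longrightarrow> - x \<in> J"
  using ideal_mult[of J x "- 1"] by simp

lemma ideal_diff: "is_ideal J \<Longrightarrow> x \<in> J \<Longrightarrow> y \<in> J \<Longrightarrow> x - y \<in> J"
  using ideal_add[of J x "- y"] ideal_uminus[of J y] by simp

lemma ideal_diff_cancel: "is_ideal J \<Longrightarrow> x - y \<in> J \<Longrightarrow> x \<in> J \<longleftrightarrow> y \<in> J"
  using ideal_diff[of J x "x - y"] ideal_add[of J y "x - y"] by auto

lemma ideal_Inter: "(\<And>J. J \<in> \<J> \<Longrightarrow> is_ideal J) \<Longrightarrow> is_ideal (\<Inter>\<J>)"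
  by (auto simp: is_ideal_def)

lemma ideal_Int: "is_ideal I \<Longrightarrow> is_ideal J \<Longrightarrow> is_ideal (I \<inter> J)"
  by (auto simp: is_ideal_def)

lemma ideal_vimage:
  assumes "is_ideal J" "f 0 = 0" "\<And>x y. f (x + y) = f x + f y" "\<And>x y. f (x * y) = f x * f y"
  shows "is_ideal (f -` J)"
  using assms by (auto simp: is_ideal_def)

lemma ideal_hull_ideal: "is_ideal (ideal_hull B)"
  unfolding ideal_hull_def by (rule ideal_Inter) auto

lemma ideal_hull_superset: "B \<subseteq> ideal_hull B"
  by (auto simp: ideal_hull_def)

lemma ideal_hull_least: "is_ideal J \<Longrightarrow> B \<subseteq> J \<Longrightarrow> ideal_hull B \<subseteq> J"
  by (auto simp: ideal_hull_def)

lemma ideal_hull_mono: "A \<subseteq> B \<Longrightarrow> ideal_hull A \<subseteq> ideal_hull B"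
  by (auto simp: ideal_hull_def)

lemma ideal_hull_eq: "is_ideal J \<Longrightarrow> ideal_hull J = J"
  by (auto simp: ideal_hull_def)

lemma ideal_adjoin:
  assumes "is_ideal J"
  shows "is_ideal {p. \<exists>a. p - a * x \<in> J}"
proof (rule is_idealI)
  fix p q r
  assume p: "p \<in> {p. \<exists>a. p - a * x \<in> J}"
  then obtain a where a: "p - a * x \<in> J"
    by blast
  show "r * p \<in> {p. \<exists>a. p - a * x \<in> J}"
    using ideal_mult[OF assms a, of r] by (auto simp: algebra_simps intro!: exI[of _ "r * a"])
  assume "q \<in> {p. \<exists>a. p - a * x \<in> J}"
  then obtain b where b: "q - b * x \<in> J"
    by blast
  show "p + q \<in> {p. \<exists>a. p - a * x \<in> J}"
    using ideal_add[OF assms a b] by (auto simp: algebra_simps intro!: exI[of _ "a + b"])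
qed (use assms in \<open>auto simp: is_ideal_def intro: exI[of _ 0]\<close>)

lemma ideal_hull_insert:
  "p \<in> ideal_hull (insert x B) \<longleftrightarrow> (\<exists>a. p - a * x \<in> ideal_hull B)" (is "_ \<longleftrightarrow> ?R")
proof
  have sub: "insert x B \<subseteq> {p. \<exists>a. p - a * x \<in> ideal_hull B}"
  proof -
    have "x - 1 * x \<in> ideal_hull B"
      by (simp add: ideal_zero ideal_hull_ideal)
    moreover have "p - 0 * x \<in> ideal_hull B" if "p \<in> B" for p
      using that ideal_hull_superset by auto
    ultimately show ?thesis
      by blast
  qed
  assume "p \<in> ideal_hull (insert x B)"
  then show ?R
    using ideal_hull_least[OF ideal_adjoin[OF ideal_hull_ideal] sub] by blast
next
  assume ?R
  then obtain a where "p - a * x \<in> ideal_hull (insert x B)"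
    using ideal_hull_mono[of B "insert x B"] by auto
  moreover have "a * x \<in> ideal_hull (insert x B)"
    using ideal_hull_superset[of "insert x B"] by (auto intro: ideal_mult ideal_hull_ideal)
  ultimately show "p \<in> ideal_hull (insert x B)"
    using ideal_add[OF ideal_hull_ideal] by fastforce
qed

section \<open>Prime and maximal ideals\<close>

lemma prime_ideal: "is_prime Q \<Longrightarrow> is_ideal Q"
  and prime_one: "is_prime Q \<Longrightarrow> 1 \<notin> Q"
  and prime_mult: "is_prime Q \<Longrightarrow> x * y \<in> Q \<Longrightarrow> x \<in> Q \<or> y \<in> Q"
  by (auto simp: is_prime_def)

lemma prime_power: "is_prime Q \<Longrightarrow> x ^ n \<in> Q \<Longrightarrow> x \<in> Q"
  by (induction n) (auto dest: prime_one prime_mult)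

lemma maximal_prime:
  assumes "is_maximal M"
  shows "is_prime M"
  unfolding is_prime_def
proof (intro conjI allI impI)
  show M: "is_ideal M" and "1 \<notin> M"
    using assms by (auto simp: is_maximal_def)
  fix x y
  assume xy: "x * y \<in> M"
  show "x \<in> M \<or> y \<in> M"
  proof (rule disjCI)
    assume "y \<notin> M"
    then obtain z where "y * z - 1 \<in> M"
      using assms by (auto simp: is_maximal_def)
    then have "z * (x * y) - x * (y * z - 1) \<in> M"
      using \<open>y * z - 1 \<in> M\<close> xy M by (simp only: ideal_diff ideal_mult)
    then show "x \<in> M"
      by (simp add: algebra_simps)
  qed
qed

text \<open>Zorn gives an ideal maximal among those above \<open>I\<close> and disjoint from
  \<open>S\<close>. Adjoining an outside \<open>x\<close> or \<open>y\<close> makes it meet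
  \<open>S\<close>; if it contained \<open>x * y\<close>, it would contain the product of the two
  elements of \<open>S\<close> found there.\<close>

lemma exists_prime_avoiding:
  assumes I: "is_ideal I" and one: "1 \<in> S" and mult: "\<And>s t. s \<in> S \<Longrightarrow> t \<in> S \<Longrightarrow> s * t \<in> S"
    and disj: "I \<inter> S = {}"
  obtains Q where "is_prime Q" "I \<subseteq> Q" "Q \<inter> S = {}"
proof -
  define A where "A = {J. is_ideal J \<and> I \<subseteq> J \<and> J \<inter> S = {}}"
  have "\<exists>M\<in>A. \<forall>X\<in>A. M \<subseteq> X \<longrightarrow> X = M"
  proof (rule subset_Zorn_nonempty)
    show "A \<noteq> {}"
      using I disj by (auto simp: A_def)
    fix C assume C: "C \<noteq> {}" "subset.chain A C"
    have id: "is_ideal J" if "J \<in> C" for J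
      using C that by (auto simp: subset.chain_def A_def)
    have "is_ideal (\<Union>C)"
    proof (rule is_idealI)
      show "0 \<in> \<Union>C"
        using C id ideal_zero by blast
      fix x y assume "x \<in> \<Union>C" "y \<in> \<Union>C"
      then obtain J J' where J: "J \<in> C" "J' \<in> C" "x \<in> J" "y \<in> J'"
        by blast
      with C(2) have "J \<subseteq> J' \<or> J' \<subseteq> J"
        by (auto simp: subset.chain_def)
      then show "x + y \<in> \<Union>C"
        using J id by (metis UnionI ideal_add in_mono)
    next
      fix x r assume "x \<in> \<Union>C"
      then show "r * x \<in> \<Union>C"
        using id ideal_mult by blast
    qed
    then show "\<Union>C \<in> A"
      using C by (fastforce simp: A_def subset.chain_def)
  qed
  then obtain M where M: "is_ideal M" "I \<subseteq> M" "M \<inter> S = {}"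
    and max: "\<And>X. is_ideal X \<Longrightarrow> I \<subseteq> X \<Longrightarrow> X \<inter> S = {} \<Longrightarrow> M \<subseteq> X \<Longrightarrow> X = M"
    by (auto simp: A_def)
  have meets: "\<exists>s\<in>S. \<exists>a. s - a * x \<in> M" if "x \<notin> M" for x
  proof (rule ccontr)
    assume contra: "\<not> ?thesis"
    have "M \<subseteq> {p. \<exists>a. p - a * x \<in> M}"
      by (auto intro: exI[of _ 0])
    then have "{p. \<exists>a. p - a * x \<in> M} = M"
      using contra M ideal_adjoin[OF M(1), of x] by (intro max) auto
    moreover have "x - 1 * x \<in> M"
      using ideal_zero[OF M(1)] by simp
    ultimately show False
      using that by blast
  qed
  have "is_prime M"
    unfolding is_prime_def
  proof (intro conjI allI impI M(1))
    show "1 \<notin> M"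
      using M one by blast
    fix x y assume xy: "x * y \<in> M"
    show "x \<in> M \<or> y \<in> M"
    proof (rule ccontr)
      assume "\<not> ?thesis"
      then obtain s a t b where st: "s \<in> S" "t \<in> S" "s - a * x \<in> M" "t - b * y \<in> M"
        using meets by meson
      have "t * (s - a * x) + a * x * (t - b * y) + a * b * (x * y) \<in> M"
        using st xy M(1) by (simp only: ideal_add ideal_mult)
      then have "s * t \<in> M"
        by (simp add: algebra_simps)
      then show False
        using mult st M(3) by blast
    qed
  qed
  then show thesis
    using M that by blast
qed

text \<open>A prime avoiding all products \<open>x ^ k * s\<close> with \<open>s\<close> outside
  \<open>Q\<close> lies in \<open>Q\<close> and misses \<open>x\<close>. The ideal \<open>I\<close>
  avoids them, because cancelling the powers of \<open>x\<close> would put \<open>s\<close> into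
  \<open>I\<close>, hence into \<open>Q\<close>.\<close>

lemma exists_smaller_prime:
  assumes I: "is_ideal I" "I \<subseteq> Q" and Q: "is_prime Q" "x \<in> Q"
    and nzd: "\<And>a. x * a \<in> I \<Longrightarrow> a \<in> I"
  obtains P where "is_prime P" "I \<subseteq> P" "P \<subset> Q"
proof -
  define S where "S = {x ^ k * s | k s. s \<notin> Q}"
  have nzd_power: "x ^ k * a \<in> I \<Longrightarrow> a \<in> I" for k a
    by (induction k) (auto simp: mult.assoc intro: nzd)
  have "1 = x ^ 0 * 1"
    by simp
  then have one: "1 \<in> S"
    using prime_one[OF Q(1)] unfolding S_def by blast
  have mult: "s * t \<in> S" if st: "s \<in> S" "t \<in> S" for s t
  proof -
    obtain k u l v where "s = x ^ k * u" "t = x ^ l * v" "u \<notin> Q" "v \<notin> Q"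
      using st unfolding S_def by blast
    then have "s * t = x ^ (k + l) * (u * v)" "u * v \<notin> Q"
      using prime_mult[OF Q(1)] by (auto simp: power_add algebra_simps)
    then show ?thesis
      unfolding S_def by blast
  qed
  have disj: "I \<inter> S = {}"
    using nzd_power I(2) by (auto simp: S_def)
  obtain P where P: "is_prime P" "I \<subseteq> P" "P \<inter> S = {}"
    using exists_prime_avoiding[OF I(1) one mult disj] by blast
  have "s \<in> S" if "s \<notin> Q" for s
    using that unfolding S_def by (intro CollectI exI[of _ 0] exI[of _ s]) simp
  moreover have "x \<in> S"
    using prime_one[OF Q(1)] unfolding S_def by (intro CollectI exI[of _ 1] exI[of _ 1]) simp
  ultimately have "P \<subset> Q"
    using P(3) Q(2) by blast
  then show thesis
    using P that by blast
qed

text \<open>Nonzerodivisor conditions in the quotient by \<open>I\<close>, written upstairs by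
  adjoining \<open>I\<close> to every partial sequence. Properness is supplied later by a maximal
  ideal containing the entries.\<close>

definition regular_modulo :: "'r::comm_ring_1 set \<Rightarrow> 'r list \<Rightarrow> bool" where
  "regular_modulo I xs \<longleftrightarrow> (\<forall>i<length xs. \<forall>a. xs ! i * a \<in> ideal_hull (set (take i xs) \<union> I)
     \<longrightarrow> a \<in> ideal_hull (set (take i xs) \<union> I))"

text \<open>The chain is built from the top. The last entry is a nonzerodivisor modulo the ideal
  \<open>H\<close> of the earlier ones, so some prime above \<open>H\<close> lies strictly below
  \<open>Q\<close>; it contains the earlier entries and becomes the top of the shorter
  chain.\<close>

lemma regular_sequence_prime_chain:
  assumes "is_ideal I" "I \<subseteq> Q" "is_prime Q" "set xs \<subseteq> Q"
    and "\<And>i a. i < length xs \<Longrightarrow> xs ! i * a \<in> ideal_hull (set (take i xs) \<union> I)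
           \<Longrightarrow> a \<in> ideal_hull (set (take i xs) \<union> I)"
  shows "\<exists>P. (\<forall>i\<le>length xs. is_prime (P i)) \<and> (\<forall>i<length xs. P i \<subset> P (Suc i)) \<and>
           P (length xs) = Q \<and> I \<subseteq> P 0"
  using assms
proof (induction xs arbitrary: Q rule: rev_induct)
  case Nil
  then show ?case
    by auto
next
  case (snoc x xs)
  define H where "H = ideal_hull (set xs \<union> I)"
  have H: "is_ideal H" "H \<subseteq> Q"
    using snoc.prems ideal_hull_least[of Q "set xs \<union> I"] prime_ideal[of Q]
    by (auto simp: H_def ideal_hull_ideal)
  have nzd: "a \<in> H" if "x * a \<in> H" for a
    using snoc.prems(5)[of "length xs" a] that by (simp add: H_def)
  have "x \<in> Q"
    using snoc.prems by simp
  then obtain Q' where Q': "is_prime Q'" "H \<subseteq> Q'" "Q' \<subset> Q"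
    using exists_smaller_prime[OF H snoc.prems(3) _ nzd] by blast
  have sub: "set xs \<union> I \<subseteq> Q'"
    using Q'(2) ideal_hull_superset[of "set xs \<union> I"] by (auto simp: H_def)
  have "\<exists>P. (\<forall>i\<le>length xs. is_prime (P i)) \<and> (\<forall>i<length xs. P i \<subset> P (Suc i)) \<and>
           P (length xs) = Q' \<and> I \<subseteq> P 0"
  proof (rule snoc.IH[OF snoc.prems(1)])
    fix i a assume "i < length xs" "xs ! i * a \<in> ideal_hull (set (take i xs) \<union> I)"
    then show "a \<in> ideal_hull (set (take i xs) \<union> I)"
      using snoc.prems(5)[of i a] by (simp add: nth_append)
  qed (use sub Q' in auto)
  then obtain P where P: "\<forall>i\<le>length xs. is_prime (P i)" "\<forall>i<length xs. P i \<subset> P (Suc i)"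
    "P (length xs) = Q'" "I \<subseteq> P 0"
    by blast
  define P' where "P' = P(Suc (length xs) := Q)"
  have "is_prime (P' i)" if "i \<le> Suc (length xs)" for i
    using that P(1) snoc.prems(3) by (auto simp: P'_def)
  moreover have "P' i \<subset> P' (Suc i)" if "i < Suc (length xs)" for i
    using that P(2,3) Q'(3) by (cases "i = length xs") (auto simp: P'_def)
  ultimately show ?case
    using P(4) by (intro exI[of _ P']) (auto simp: P'_def)
qed

section \<open>The Cohen-Macaulay property through a presentation\<close>

text \<open>Ideals of the carrier-based ring \<open>R\<close> correspond to the ideals of a ring
  type that contain the kernel of a surjection \<open>h\<close>. This carries all arguments over to
  the type.\<close>

locale presented_ring = cring R for R (structure) +
  fixes h :: "'r::comm_ring_1 \<Rightarrow> 'a"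
  assumes h_add: "h (x + y) = h x \<oplus> h y"
    and h_mult: "h (x * y) = h x \<otimes> h y"
    and h_one: "h 1 = \<one>"
    and range_h: "range h = carrier R"
begin

lemma h_closed [simp]: "h x \<in> carrier R"
  using range_h by blast

lemma h_surj: "y \<in> carrier R \<Longrightarrow> \<exists>x. y = h x"
  using range_h by blast

lemma h_zero: "h 0 = \<zero>"
  using h_add[of 0 0] add.l_cancel_one' by simp

lemma h_uminus: "h (- x) = \<ominus> h x"
proof -
  have "h (- x) \<oplus> h x = \<zero>"
    using h_add[of "- x" x] h_zero by simp
  then show ?thesis
    by (intro minus_equality[symmetric]) simp_all
qed

definition Ker :: "'r set" where
  "Ker = {x. h x = \<zero>}"

lemma h_eq_imp: "h x = h y \<Longrightarrow> x - y \<in> Ker"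
  using h_add[of x "- y"] by (simp add: Ker_def h_uminus r_neg)

lemma vimage_is_ideal:
  assumes "ideal J R"
  shows "is_ideal (h -` J)"
proof -
  interpret J: ideal J R by fact
  show ?thesis
    by (rule is_idealI) (auto simp: h_zero h_add h_mult J.I_l_closed)
qed

lemma Ker_le_vimage: "ideal J R \<Longrightarrow> Ker \<subseteq> h -` J"
  by (auto simp: Ker_def additive_subgroup.zero_closed[OF ideal.axioms(1)])

lemma Ker_ideal: "is_ideal Ker"
  using vimage_is_ideal[OF zeroideal] by (simp add: Ker_def vimage_def)

lemma image_ideal:
  assumes J: "is_ideal J"
  shows "ideal (h ` J) R"
proof (rule idealI[OF ring_axioms])
  show "subgroup (h ` J) (add_monoid R)"
  proof (rule add.subgroupI)
    show "h ` J \<subseteq> carrier R" "h ` J \<noteq> {}"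
      using ideal_zero[OF J] by auto
    fix a assume "a \<in> h ` J"
    then show "\<ominus> a \<in> h ` J"
      using ideal_uminus[OF J] by (auto simp flip: h_uminus)
  next
    fix a b assume "a \<in> h ` J" "b \<in> h ` J"
    then show "a \<oplus> b \<in> h ` J"
      using ideal_add[OF J] by (auto simp flip: h_add)
  qed
  fix a x assume a: "a \<in> h ` J" and x: "x \<in> carrier R"
  show "x \<otimes> a \<in> h ` J"
    using a h_surj[OF x] ideal_mult[OF J] by (auto simp flip: h_mult)
  then show "a \<otimes> x \<in> h ` J"
    using a x by (auto simp: m_comm)
qed

lemma h_mem_image_iff: "is_ideal J \<Longrightarrow> Ker \<subseteq> J \<Longrightarrow> h x \<in> h ` J \<longleftrightarrow> x \<in> J"
  using h_eq_imp ideal_diff_cancel by blast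

lemma vimage_prime:
  assumes "primeideal P R"
  shows "is_prime (h -` P)"
proof -
  interpret P: primeideal P R by fact
  have "\<one> \<notin> P"
    using P.one_imp_carrier P.I_notcarr by auto
  then show ?thesis
    using vimage_is_ideal[OF P.is_ideal] P.I_prime
    by (auto simp: is_prime_def h_one h_mult)
qed

lemma image_prime:
  assumes Q: "is_prime Q" "Ker \<subseteq> Q"
  shows "primeideal (h ` Q) R"
proof (rule primeidealI[OF image_ideal is_cring])
  show Qi: "is_ideal Q"
    by (rule prime_ideal[OF Q(1)])
  note mem = h_mem_image_iff[OF Qi Q(2)]
  have "h 1 \<notin> h ` Q"
    using prime_one[OF Q(1)] by (simp add: mem)
  then show "carrier R \<noteq> h ` Q"
    by auto
  fix a b assume ab: "a \<in> carrier R" "b \<in> carrier R" "a \<otimes> b \<in> h ` Q"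
  obtain x y where "a = h x" "b = h y"
    using h_surj ab by blast
  then show "a \<in> h ` Q \<or> b \<in> h ` Q"
    using ab(3) prime_mult[OF Q(1)] by (simp add: mem flip: h_mult)
qed

lemma vimage_maximal:
  assumes "maximalideal M R"
  shows "is_maximal (h -` M)"
proof -
  interpret M: maximalideal M R by fact
  have one: "\<one> \<notin> M"
    using M.one_imp_carrier M.I_notcarr by auto
  note iM = vimage_is_ideal[OF M.is_ideal]
  have "\<exists>y. h (x * y - 1) \<in> M" if "h x \<notin> M" for x
  proof -
    \<comment> \<open>\<open>J\<close> is the preimage of \<open>M\<close> with \<open>x\<close>
      adjoined; its image exceeds \<open>M\<close> and is therefore everything, which expresses 1
      through \<open>x\<close> modulo \<open>M\<close>.\<close>
    define J where "J = {p. \<exists>a. p - a * x \<in> h -` M}"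
    have J: "is_ideal J"
      unfolding J_def by (rule ideal_adjoin[OF iM])
    have "M \<subseteq> h ` J"
    proof
      fix m assume m: "m \<in> M"
      then obtain p where "m = h p"
        using h_surj M.Icarr by blast
      then show "m \<in> h ` J"
        using m by (auto simp: J_def intro!: imageI exI[of _ 0])
    qed
    moreover have "h x \<in> h ` J"
      using ideal_zero[OF iM] by (auto simp: J_def intro!: imageI exI[of _ 1])
    ultimately have "h ` J = carrier R"
      using M.I_maximal[OF image_ideal[OF J]] that by (metis h_closed image_subsetI)
    then have "h 1 \<in> h ` J"
      by simp
    moreover have "Ker \<subseteq> J"
      using Ker_le_vimage[OF M.is_ideal] by (auto simp: J_def intro!: exI[of _ 0])
    ultimately have "1 \<in> J"
      using h_mem_image_iff[OF J] by blast
    then obtain y where "1 - y * x \<in> h -` M"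
      by (auto simp: J_def)
    then have "- (1 - y * x) \<in> h -` M"
      by (rule ideal_uminus[OF iM])
    then show ?thesis
      by (intro exI[of _ y]) (simp add: mult.commute)
  qed
  then show ?thesis
    using iM one by (auto simp: is_maximal_def h_one)
qed

text \<open>The dictionary for regular sequences and finite generation: an ideal generated in
  \<open>R\<close> becomes a hull with the kernel adjoined.\<close>

lemma genideal_image_iff: "h x \<in> Idl (h ` B) \<longleftrightarrow> x \<in> ideal_hull (B \<union> Ker)"
proof
  have K: "Ker \<subseteq> ideal_hull (B \<union> Ker)"
    using ideal_hull_superset[of "B \<union> Ker"] by blast
  have "Idl (h ` B) \<subseteq> h ` ideal_hull (B \<union> Ker)"
    using ideal_hull_superset[of "B \<union> Ker"]
    by (intro genideal_minimal image_ideal ideal_hull_ideal) auto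
  then show "h x \<in> Idl (h ` B) \<Longrightarrow> x \<in> ideal_hull (B \<union> Ker)"
    using h_mem_image_iff[OF ideal_hull_ideal K] by blast
next
  have "ideal (Idl (h ` B)) R"
    by (rule genideal_ideal) auto
  moreover from this have "B \<union> Ker \<subseteq> h -` (Idl (h ` B))"
    using Ker_le_vimage[of "Idl (h ` B)"] genideal_self[of "h ` B"]
    by (simp add: image_subset_iff_subset_vimage subsetI)
  ultimately have "ideal_hull (B \<union> Ker) \<subseteq> h -` (Idl (h ` B))"
    by (intro ideal_hull_least vimage_is_ideal)
  then show "x \<in> ideal_hull (B \<union> Ker) \<Longrightarrow> h x \<in> Idl (h ` B)"
    by blast
qed

lemma regular_modulo_iff:
  "(\<forall>i < length (map h xs). \<forall>a \<in> carrier R.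
     map h xs ! i \<otimes> a \<in> Idl (set (take i (map h xs))) \<longrightarrow> a \<in> Idl (set (take i (map h xs))))
   \<longleftrightarrow> regular_modulo Ker xs"
proof -
  have "(\<forall>a \<in> carrier R. h x \<otimes> a \<in> Idl (h ` B) \<longrightarrow> a \<in> Idl (h ` B)) \<longleftrightarrow>
    (\<forall>a. x * a \<in> ideal_hull (B \<union> Ker) \<longrightarrow> a \<in> ideal_hull (B \<union> Ker))" for x B
    unfolding range_h[symmetric] by (simp add: genideal_image_iff flip: h_mult)
  then show ?thesis
    unfolding regular_modulo_def by (simp add: take_map)
qed

lemma prime_height_le:
  assumes no_chain: "\<And>Q :: nat \<Rightarrow> 'r set. (\<And>i. i \<le> Suc d \<Longrightarrow> is_prime (Q i)) \<Longrightarrow>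
    (\<And>i. i \<le> d \<Longrightarrow> Q i \<subset> Q (Suc i)) \<Longrightarrow> Ker \<subseteq> Q 0 \<Longrightarrow> False"
  shows "prime_height R P \<le> enat d"
  unfolding prime_height_def
proof (rule SUP_least, rule ccontr)
  fix n assume "n \<in> {n. \<exists>Q. (\<forall>i\<le>n. primeideal (Q i) R) \<and> (\<forall>i<n. Q i \<subset> Q (Suc i)) \<and> Q n = P}"
    and "\<not> enat n \<le> enat d"
  then obtain Q where Q: "\<forall>i\<le>n. primeideal (Q i) R" "\<forall>i<n. Q i \<subset> Q (Suc i)" and n: "Suc d \<le> n"
    by auto
  have id: "ideal (Q i) R" if "i \<le> n" for i
    using Q(1) that primeideal.axioms(1) by blast
  show False
  proof (rule no_chain[of "\<lambda>i. h -` Q i"])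
    fix i assume "i \<le> d"
    then have *: "i < n"
      using n by simp
    then obtain y where y: "y \<in> Q (Suc i)" "y \<notin> Q i"
      using Q(2) by blast
    moreover obtain x where "y = h x"
      using y(1) id[of "Suc i"] * ideal.Icarr h_surj by (metis Suc_leI)
    ultimately show "h -` Q i \<subset> h -` Q (Suc i)"
      using Q(2) * by blast
  qed (use Q id n Ker_le_vimage in \<open>auto intro: vimage_prime\<close>)
qed

lemma ideal_depth_le_prime_height:
  assumes M: "primeideal M R"
  shows "ideal_depth R M \<le> prime_height R M"
  unfolding ideal_depth_def
proof (rule SUP_least)
  interpret M: primeideal M R by fact
  fix ys assume "ys \<in> {xs. regular_sequence R xs \<and> set xs \<subseteq> M}"
  then have ys: "regular_sequence R ys" "set ys \<subseteq> M"
    by auto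
  have "\<forall>y\<in>set ys. \<exists>x. y = h x"
    using ys(2) M.Icarr h_surj by blast
  then obtain g where "\<forall>y\<in>set ys. y = h (g y)"
    by metis
  then have "ys = map h (map g ys)"
    by (simp add: map_idI)
  then obtain xs where xs: "ys = map h xs" ..
  have reg: "regular_modulo Ker xs"
    using ys(1) regular_modulo_iff[of xs] unfolding regular_sequence_def xs by blast
  obtain P where P: "\<forall>i\<le>length xs. is_prime (P i)" "\<forall>i<length xs. P i \<subset> P (Suc i)"
    "P (length xs) = h -` M" "Ker \<subseteq> P 0"
  proof -
    have "set xs \<subseteq> h -` M"
      using ys(2) by (auto simp: xs)
    from regular_sequence_prime_chain[OF Ker_ideal Ker_le_vimage[OF M.is_ideal] vimage_prime[OF M] this]
    show ?thesis
      using reg that unfolding regular_modulo_def by blast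
  qed
  \<comment> \<open>Strictness could be lost under \<open>h\<close>; it survives because every
    member of the chain contains the kernel.\<close>
  have Ker_le: "i \<le> length xs \<Longrightarrow> Ker \<subseteq> P i" for i
  proof (induction i)
    case (Suc i)
    then show ?case
      using P(2)[rule_format, of i] by auto
  qed (use P(4) in simp)
  have "primeideal (h ` P i) R" if "i \<le> length xs" for i
    using P(1) Ker_le that by (auto intro: image_prime)
  moreover have "h ` P i \<subset> h ` P (Suc i)" if i: "i < length xs" for i
  proof -
    obtain x where "x \<in> P (Suc i)" "x \<notin> P i"
      using P(2) i by blast
    then have "h x \<in> h ` P (Suc i)" "h x \<notin> h ` P i"
      using P(1) i Ker_le[of i] by (auto simp: h_mem_image_iff prime_ideal)
    then show ?thesis
      using P(2) i by blast
  qed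
  moreover have "h ` P (length xs) = M"
    using P(3) range_h M.a_subset by auto
  ultimately have "\<exists>Q. (\<forall>i\<le>length xs. primeideal (Q i) R) \<and>
      (\<forall>i<length xs. Q i \<subset> Q (Suc i)) \<and> Q (length xs) = M"
    by (intro exI[of _ "\<lambda>i. h ` P i"]) blast
  then have "enat (length xs) \<le> prime_height R M"
    unfolding prime_height_def by (intro SUP_upper) simp
  then show "enat (length ys) \<le> prime_height R M"
    by (simp add: xs)
qed

text \<open>Depth and height are squeezed: the sequences in \<open>regular\<close> give
  \<open>d <= depth\<close>, and \<open>no_chain\<close> gives \<open>height <= d\<close>.\<close>

lemma cohen_macaulay_ringI:
  assumes noeth: "\<And>J. is_ideal J \<Longrightarrow> Ker \<subseteq> J \<Longrightarrow> \<exists>B. finite B \<and> J = ideal_hull (B \<union> Ker)"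
    and no_chain: "\<And>Q :: nat \<Rightarrow> 'r set. (\<And>i. i \<le> Suc d \<Longrightarrow> is_prime (Q i)) \<Longrightarrow>
      (\<And>i. i \<le> d \<Longrightarrow> Q i \<subset> Q (Suc i)) \<Longrightarrow> Ker \<subseteq> Q 0 \<Longrightarrow> False"
    and regular: "\<And>M. is_maximal M \<Longrightarrow> Ker \<subseteq> M \<Longrightarrow>
      \<exists>xs. length xs = d \<and> set xs \<subseteq> M \<and> regular_modulo Ker xs"
  shows "cohen_macaulay_ring R"
  unfolding cohen_macaulay_ring_def
proof (intro conjI allI impI)
  show "cring R"
    by (rule is_cring)
  show "noetherian_ring R"
  proof (rule noetherian_ringI)
    fix J assume J: "ideal J R"
    obtain B where B: "finite B" "h -` J = ideal_hull (B \<union> Ker)"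
      using noeth[OF vimage_is_ideal[OF J] Ker_le_vimage[OF J]] by blast
    have "y \<in> J \<longleftrightarrow> y \<in> Idl (h ` B)" for y
    proof (cases "y \<in> carrier R")
      case True
      then obtain x where x: "y = h x"
        using h_surj by blast
      have "h x \<in> J \<longleftrightarrow> x \<in> h -` J"
        by simp
      then show ?thesis
        unfolding x genideal_image_iff B(2) .
    next
      case False
      then show ?thesis
        using ideal.Icarr[OF J] ideal.Icarr[OF genideal_ideal[of "h ` B"]]
        by (meson h_closed image_subsetI)
    qed
    then show "\<exists>A\<subseteq>carrier R. finite A \<and> J = Idl A"
      using B(1) by (intro exI[of _ "h ` B"]) auto
  qed
  fix M assume max: "maximalideal M R"
  interpret M: maximalideal M R by fact
  have M: "primeideal M R"
    by (rule maximalideal_prime[OF max])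
  obtain xs where xs: "length xs = d" "set xs \<subseteq> h -` M" "regular_modulo Ker xs"
    using regular[OF vimage_maximal[OF max] Ker_le_vimage[OF M.is_ideal]] by blast
  have sub: "set (map h xs) \<subseteq> M"
    using xs(2) by auto
  have "Idl (set (map h xs)) \<subseteq> M"
    by (rule genideal_minimal[OF M.is_ideal sub])
  then have "regular_sequence R (map h xs)"
    using xs(3) M.I_notcarr M.a_subset regular_modulo_iff[of xs]
    unfolding regular_sequence_def by auto
  then have "enat (length (map h xs)) \<le> ideal_depth R M"
    unfolding ideal_depth_def using sub by (intro SUP_upper) auto
  then have "enat d \<le> ideal_depth R M"
    by (simp add: xs(1))
  moreover have "prime_height R M \<le> enat d"
    by (rule prime_height_le) (rule no_chain)
  ultimately show "ideal_depth R M = prime_height R M"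
    using ideal_depth_le_prime_height[OF M] by order
qed

end

section \<open>Ring homomorphisms and polynomials\<close>

locale ring_morphism =
  fixes f :: "'a::comm_ring_1 \<Rightarrow> 'b::comm_ring_1"
  assumes hom_add: "f (x + y) = f x + f y"
    and hom_mult: "f (x * y) = f x * f y"
    and hom_one: "f 1 = 1"
begin

lemma hom_zero: "f 0 = 0"
  using hom_add[of 0 0] by simp

lemma hom_uminus: "f (- x) = - f x"
  using hom_add[of "- x" x] by (simp add: hom_zero eq_neg_iff_add_eq_0)

lemma hom_diff: "f (x - y) = f x - f y"
  using hom_add[of x "- y"] by (simp add: hom_uminus)

lemma hom_sum: "f (sum g A) = (\<Sum>x\<in>A. f (g x))"
  by (induction A rule: infinite_finite_induct) (auto simp: hom_zero hom_add)

lemma hom_prod: "f (prod g A) = (\<Prod>x\<in>A. f (g x))"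
  by (induction A rule: infinite_finite_induct) (auto simp: hom_one hom_mult)

lemma hom_vimage_ideal: "is_ideal J \<Longrightarrow> is_ideal (f -` J)"
  by (rule ideal_vimage) (auto simp: hom_zero hom_add hom_mult)

text \<open>Substitution after moving the coefficients along \<open>f\<close>. Applied twice, it
  yields evaluation of polynomials in two variables.\<close>

lemma peval_morphism: "ring_morphism (\<lambda>p. poly (map_poly f p) x)"
proof
  fix p q
  have add: "map_poly f (p + q) = map_poly f p + map_poly f q"
    by (rule poly_eqI) (simp add: coeff_map_poly hom_zero hom_add)
  have mult: "map_poly f (p * q) = map_poly f p * map_poly f q"
    by (rule poly_eqI) (simp add: coeff_map_poly hom_zero coeff_mult hom_sum hom_mult)
  show "poly (map_poly f (p + q)) x = poly (map_poly f p) x + poly (map_poly f q) x"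
    "poly (map_poly f (p * q)) x = poly (map_poly f p) x * poly (map_poly f q) x"
    by (simp_all add: add mult)
qed (simp add: map_poly_1' hom_one)

lemma peval_const: "poly (map_poly f [:c:]) x = f c"
  by (simp add: map_poly_pCons hom_zero)

lemma peval_X: "poly (map_poly f [:0, 1:]) x = x"
  by (simp add: map_poly_pCons hom_zero hom_one)

end

section \<open>Univariate and bivariate polynomials: cancellation and Zariski's lemma\<close>

lemma ring_morphism_comp: "ring_morphism f \<Longrightarrow> ring_morphism g \<Longrightarrow> ring_morphism (\<lambda>x. g (f x))"
  by (simp add: ring_morphism_def)

lemma poly_morphism_eqI:
  assumes "ring_morphism f" "ring_morphism g" "\<And>c. f [:c:] = g [:c:]" "f [:0, 1:] = g [:0, 1:]"
  shows "f p = g p"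
proof (induction p)
  case 0
  then show ?case
    using assms(3)[of 0] by simp
next
  case (pCons a p)
  interpret f: ring_morphism f by fact
  interpret g: ring_morphism g by fact
  have "pCons a p = [:a:] + [:0, 1:] * p"
    by simp
  then show ?case
    using pCons assms(3)[of a] assms(4) by (metis f.hom_add f.hom_mult g.hom_add g.hom_mult)
qed

text \<open>Modulo \<open>c\<close> the leading coefficient of \<open>G\<close> stays invertible, so
  \<open>G\<close> is a nonzerodivisor there. In terms of divisibility: \<open>c\<close> divides the
  top coefficient of \<open>G * a\<close>, hence that of \<open>a\<close>, and the leading term of
  \<open>a\<close> can be stripped off.\<close>

lemma const_dvd_mult_cancel:
  fixes G :: "'a::idom poly"
  assumes unit: "lead_coeff G dvd 1" and "[:c:] dvd G * a"
  shows "[:c:] dvd a"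
proof -
  have "\<forall>a. degree a < n \<longrightarrow> [:c:] dvd G * a \<longrightarrow> [:c:] dvd a" for n
  proof (induction n)
    case (Suc n)
    show ?case
    proof (intro allI impI)
      fix a assume a: "degree a < Suc n" "[:c:] dvd G * a"
      obtain u where u: "1 = lead_coeff G * u"
        using unit by (rule dvdE)
      have "c dvd coeff (G * a) (degree G + degree a)"
        using a(2) by (simp add: const_poly_dvd_iff)
      then have "c dvd u * (lead_coeff G * lead_coeff a)"
        by (simp add: coeff_mult_degree_sum)
      also have "\<dots> = lead_coeff a"
        using u by (metis mult.assoc mult.commute mult_1)
      finally have lead: "[:c:] dvd monom (lead_coeff a) (degree a)"
        by (simp add: const_poly_dvd_iff)
      define a' where "a' = a - monom (lead_coeff a) (degree a)"
      have "[:c:] dvd G * a - G * monom (lead_coeff a) (degree a)"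
        by (rule dvd_diff[OF a(2) dvd_mult[OF lead]])
      then have a': "[:c:] dvd G * a'"
        by (simp add: a'_def algebra_simps)
      have "[:c:] dvd a'"
      proof (cases "degree a = 0")
        case True
        then have "a' = 0"
          by (metis a'_def degree_0_id eq_iff_diff_eq_0 monom_0 of_nat_0)
        then show ?thesis
          by simp
      next
        case False
        have "degree a' \<le> degree a - 1"
        proof (rule degree_le, intro allI impI)
          fix i assume "degree a - 1 < i"
          then show "coeff a' i = 0"
            by (cases "i = degree a") (auto simp: a'_def coeff_eq_0)
        qed
        then show ?thesis
          using Suc a(1) a' False by auto
      qed
      then show "[:c:] dvd a"
        using lead dvd_add[of "[:c:]" a' "monom (lead_coeff a) (degree a)"] by (simp add: a'_def)
    qed
  qed simp
  then show ?thesis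
    using assms(2) by blast
qed

text \<open>
  Zariski's lemma for two generators. Otherwise take \<open>g\<close> of least degree in the second
  variable and let \<open>c\<close> be its leading coefficient; reducing an inverse of \<open>p = 1 + X c\<close> modulo \<open>g\<close>
  gives \<open>p dvd c ^ N\<close>, although \<open>p\<close> is coprime to \<open>c\<close>.
\<close>

lemma maximal_ideal_meets_univariate:
  fixes J :: "'k::field poly poly set"
  assumes "is_maximal J"
  obtains f where "f \<noteq> 0" "[:f:] \<in> J"
proof (rule ccontr)
  assume "\<not> thesis"
  then have none: "f = 0" if "[:f:] \<in> J" for f
    using that \<open>\<And>f. f \<noteq> 0 \<Longrightarrow> [:f:] \<in> J \<Longrightarrow> thesis\<close> by blast
  have J: "is_ideal J" "1 \<notin> J" and inv: "\<And>x. x \<notin> J \<Longrightarrow> \<exists>y. x * y - 1 \<in> J"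
    using assms by (auto simp: is_maximal_def)
  \<comment> \<open>Otherwise the outer variable would be invertible in \<open>K[X][Y]\<close>,
    which the constant coefficients rule out.\<close>
  have "\<exists>g\<in>J. g \<noteq> 0"
  proof (rule ccontr)
    assume "\<not> ?thesis"
    then have "J \<subseteq> {0}"
      by blast
    moreover from this have "[:0, 1:] \<notin> J"
      by auto
    ultimately obtain y where "[:0, 1:] * y - (1::'k poly poly) = 0"
      using inv[of "[:0, 1:]"] by blast
    then have "[:0, 1:] * y = (1::'k poly poly)"
      by simp
    then have "coeff ([:0, 1:] * y) 0 = coeff (1::'k poly poly) 0"
      by (rule arg_cong)
    then show False
      by (simp add: coeff_mult)
  qed
  then obtain g where g: "g \<in> J" "g \<noteq> 0" and least: "\<And>p. p \<in> J \<Longrightarrow> p \<noteq> 0 \<Longrightarrow> degree g \<le> degree p"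
    using ex_has_least_nat[of "\<lambda>g. g \<in> J \<and> g \<noteq> 0" _ degree] by blast
  have deg: "0 < degree g"
    using none g by (metis degree_eq_zeroE gr0I pCons_0_0)
  define c where "c = lead_coeff g"
  define p where "p = 1 + [:0, 1:] * c"
  have "c \<noteq> 0"
    using g by (simp add: c_def)
  then have deg_p: "0 < degree p"
    unfolding p_def by (subst degree_add_eq_right) (auto simp: degree_mult_eq)
  then have "[:p:] \<notin> J"
    using none by force
  then obtain y where y: "[:p:] * y - 1 \<in> J"
    using inv by blast
  define r where "r = pseudo_mod y g"
  obtain q N where q: "smult (c ^ N) y = g * q + r" and r: "r = 0 \<or> degree r < degree g"
    using pseudo_divmod[OF g(2)] unfolding r_def pseudo_mod_def c_def by (metis prod.collapse)
  \<comment> \<open>Multiplying \<open>p * y = 1\<close> by \<open>c ^ N\<close> and discarding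
    multiples of \<open>g\<close> leaves \<open>s\<close> in \<open>J\<close>. Its degree is below
    the least one, so it vanishes.\<close>
  define s where "s = [:c ^ N:] - smult p r"
  have "[:c ^ N:] * ([:p:] * y - 1) - [:p:] * q * g \<in> J"
    using y g(1) J(1) by (simp only: ideal_diff ideal_mult)
  also have "[:c ^ N:] * ([:p:] * y - 1) - [:p:] * q * g = - s"
    using arg_cong[OF q, of "smult p"] by (simp add: s_def algebra_simps smult_diff_right smult_add_right)
  finally have "s \<in> J"
    using ideal_uminus[OF J(1)] by fastforce
  moreover have "degree s < degree g"
    using r deg unfolding s_def by (intro degree_diff_less) (auto simp: degree_smult_eq)
  ultimately have "s = 0"
    using least by force
  then have "c ^ N = p * coeff r 0"
    unfolding s_def by (metis coeff_pCons_0 coeff_smult eq_iff_diff_eq_0)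
  then have "p dvd c ^ N"
    by simp
  moreover have "is_unit p" if "p dvd c ^ n" for n
    using that
  proof (induction n)
    case (Suc n)
    \<comment> \<open>Since \<open>p = 1 + X * c\<close>, divisibility passes from
      \<open>c ^ Suc n\<close> down to \<open>c ^ n\<close>, and finally to 1.\<close>
    have "c ^ n = p * c ^ n - [:0, 1:] * c ^ Suc n"
      by (simp add: p_def algebra_simps)
    also have "p dvd \<dots>"
      using Suc.prems by (intro dvd_diff dvd_triv_left dvd_mult)
    finally show ?case
      by (rule Suc.IH)
  qed simp
  ultimately have "is_unit p"
    by blast
  then show False
    using deg_p by (auto simp: is_unit_poly_iff)
qed

section \<open>Noetherian rings\<close>

definition finitely_generated_ideals :: "'r::comm_ring_1 itself \<Rightarrow> bool" where
  "finitely_generated_ideals _ \<longleftrightarrow> (\<forall>J :: 'r set. is_ideal J \<longrightarrow> (\<exists>B. finite B \<and> J = ideal_hull B))"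

lemma finitely_generated_ideals_field: "finitely_generated_ideals TYPE('k::field)"
  unfolding finitely_generated_ideals_def
proof (intro allI impI)
  fix J :: "'k set" assume J: "is_ideal J"
  show "\<exists>B. finite B \<and> J = ideal_hull B"
  proof (cases "J = {0}")
    case True
    then show ?thesis
      using J by (intro exI[of _ J]) (simp add: ideal_hull_eq)
  next
    case False
    then obtain x where x: "x \<in> J" "x \<noteq> 0"
      using ideal_zero[OF J] by blast
    have "y \<in> ideal_hull {x}" for y
      using ideal_mult[OF ideal_hull_ideal, of x "{x}" "y / x"] x ideal_hull_superset[of "{x}"] by simp
    moreover have "ideal_hull {x} \<subseteq> J"
      using x J by (intro ideal_hull_least) auto
    ultimately show ?thesis
      by (intro exI[of _ "{x}"]) auto
  qed
qed

lemma finite_subset_incseq_Union: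
  fixes L :: "nat \<Rightarrow> 'a set"
  assumes "finite B" "B \<subseteq> (\<Union>n. L n)" "\<And>m n. m \<le> n \<Longrightarrow> L m \<subseteq> L n"
  shows "\<exists>n. B \<subseteq> L n"
  using assms(1,2)
proof (induction B)
  case (insert x B)
  then obtain m n where "B \<subseteq> L m" "x \<in> L n"
    by auto
  then have "insert x B \<subseteq> L (max m n)"
    using assms(3)[of m "max m n"] assms(3)[of n "max m n"] by auto
  then show ?case ..
qed auto

text \<open>The leading coefficient ideals \<open>L n\<close> increase and are constant from some
  \<open>n0\<close> on, because their union is finitely generated. Lifts of generators of the
  \<open>L n\<close> with \<open>n <= n0\<close> then suffice to lower the degree of any element of
  \<open>J\<close>.\<close>

lemma hilbert_basis:
  assumes noeth: "finitely_generated_ideals TYPE('a::comm_ring_1)"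
  shows "finitely_generated_ideals TYPE('a poly)"
  unfolding finitely_generated_ideals_def
proof (intro allI impI)
  fix J :: "'a poly set" assume J: "is_ideal J"
  \<comment> \<open>Bounding the degree by \<open>n\<close> instead of fixing it admits the
    coefficient 0 and makes \<open>L n\<close> an ideal.\<close>
  define L where "L n = {c. \<exists>p\<in>J. degree p \<le> n \<and> coeff p n = c}" for n
  have L_ideal: "is_ideal (L n)" for n
  proof (rule is_idealI)
    show "0 \<in> L n"
      using ideal_zero[OF J] by (auto simp: L_def intro!: bexI[of _ 0])
    fix x y assume "x \<in> L n" "y \<in> L n"
    then obtain p q where pq: "p \<in> J" "degree p \<le> n" "coeff p n = x"
        "q \<in> J" "degree q \<le> n" "coeff q n = y"
      unfolding L_def by blast
    then show "x + y \<in> L n"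
      unfolding L_def by (auto intro!: bexI[of _ "p + q"] degree_add_le ideal_add[OF J])
  next
    fix x r assume "x \<in> L n"
    then obtain p where p: "p \<in> J" "degree p \<le> n" "coeff p n = x"
      unfolding L_def by blast
    then have "[:r:] * p \<in> J"
      by (intro ideal_mult[OF J])
    then show "r * x \<in> L n"
      using p order_trans[OF degree_smult_le p(2)]
      unfolding L_def by (auto intro!: bexI[of _ "smult r p"])
  qed
  have L_mono: "L m \<subseteq> L n" if mn: "m \<le> n" for m n
  proof
    fix x assume "x \<in> L m"
    then obtain p where p: "p \<in> J" "degree p \<le> m" "coeff p m = x"
      unfolding L_def by blast
    have "monom 1 (n - m) * p \<in> J"
      using p by (intro ideal_mult[OF J])
    moreover have "degree (monom 1 (n - m) * p) \<le> n"
      using degree_mult_le[of "monom 1 (n - m)" p] degree_monom_le[of "1::'a" "n - m"] p mn by simp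
    moreover have "coeff (monom 1 (n - m) * p) n = x"
      using p mn by (simp add: coeff_monom_mult)
    ultimately show "x \<in> L n"
      unfolding L_def by blast
  qed
  have "is_ideal (\<Union>n. L n)"
  proof (rule is_idealI)
    show "0 \<in> (\<Union>n. L n)"
      using ideal_zero[OF L_ideal] by blast
    fix x y assume "x \<in> (\<Union>n. L n)" "y \<in> (\<Union>n. L n)"
    then obtain m n where "x \<in> L m" "y \<in> L n"
      by blast
    then have "x \<in> L (max m n)" "y \<in> L (max m n)"
      using L_mono by (meson in_mono max.cobounded1 max.cobounded2)+
    then show "x + y \<in> (\<Union>n. L n)"
      using ideal_add[OF L_ideal] by blast
  next
    fix x r assume "x \<in> (\<Union>n. L n)"
    then show "r * x \<in> (\<Union>n. L n)"
      using ideal_mult[OF L_ideal] by blast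
  qed
  then obtain B where B: "finite B" "(\<Union>n. L n) = ideal_hull B"
    using noeth unfolding finitely_generated_ideals_def by blast
  obtain n0 where "B \<subseteq> L n0"
    using finite_subset_incseq_Union[of B L] B ideal_hull_superset[of B] L_mono by blast
  then have n0: "L n \<subseteq> L n0" for n
    using B(2) ideal_hull_least[OF L_ideal, of B n0] by blast
  have "\<exists>B. finite B \<and> L n = ideal_hull B" for n
    using noeth L_ideal unfolding finitely_generated_ideals_def by blast
  then obtain B where B: "\<And>n. finite (B n)" "\<And>n. L n = ideal_hull (B n)"
    by metis
  define P where "P n c = (SOME p. p \<in> J \<and> degree p \<le> n \<and> coeff p n = c)" for n c
  have P: "P n c \<in> J \<and> degree (P n c) \<le> n \<and> coeff (P n c) n = c" if "c \<in> B n" for n c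
    unfolding P_def
  proof (rule someI_ex)
    have "c \<in> L n"
      using that ideal_hull_superset[of "B n"] B(2) by blast
    then show "\<exists>p. p \<in> J \<and> degree p \<le> n \<and> coeff p n = c"
      unfolding L_def by blast
  qed
  define G where "G = (\<Union>n\<in>{..n0}. P n ` B n)"
  have lead: "\<exists>q\<in>ideal_hull G. degree q \<le> i \<and> coeff q i = c" if i: "i \<le> n0" and c: "c \<in> L i" for i c
  proof -
    define A where "A = {c. \<exists>q\<in>ideal_hull G. degree q \<le> i \<and> coeff q i = c}"
    have "is_ideal A"
    proof (rule is_idealI)
      show "0 \<in> A"
        using ideal_zero[OF ideal_hull_ideal] by (auto simp: A_def intro!: bexI[of _ 0])
      fix x y assume "x \<in> A" "y \<in> A"
      then obtain p q where pq: "p \<in> ideal_hull G" "degree p \<le> i" "coeff p i = x"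
          "q \<in> ideal_hull G" "degree q \<le> i" "coeff q i = y"
        unfolding A_def by blast
      then show "x + y \<in> A"
        unfolding A_def by (auto intro!: bexI[of _ "p + q"] degree_add_le ideal_add[OF ideal_hull_ideal])
    next
      fix x r assume "x \<in> A"
      then obtain p where p: "p \<in> ideal_hull G" "degree p \<le> i" "coeff p i = x"
        unfolding A_def by blast
      then have "[:r:] * p \<in> ideal_hull G"
        by (intro ideal_mult[OF ideal_hull_ideal])
      then show "r * x \<in> A"
        using p order_trans[OF degree_smult_le p(2)]
        unfolding A_def by (auto intro!: bexI[of _ "smult r p"])
    qed
    moreover have "B i \<subseteq> A"
    proof
      fix c assume c: "c \<in> B i"
      then have "P i c \<in> ideal_hull G"
        using i ideal_hull_superset[of G] by (auto simp: G_def)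
      then show "c \<in> A"
        using P[OF c] by (auto simp: A_def)
    qed
    ultimately have "ideal_hull (B i) \<subseteq> A"
      by (rule ideal_hull_least)
    then show ?thesis
      using c by (auto simp: A_def B(2))
  qed
  have "\<forall>p\<in>J. degree p < n \<longrightarrow> p \<in> ideal_hull G" for n
  proof (induction n)
    case (Suc n)
    show ?case
    proof (intro ballI impI)
      fix p assume p: "p \<in> J" "degree p < Suc n"
      \<comment> \<open>Beyond \<open>n0\<close> the coefficient is already realised in degree
        \<open>n0\<close>; a power of the variable shifts it up to degree \<open>n\<close>.\<close>
      define i where "i = min n n0"
      have "coeff p n \<in> L n"
        using p unfolding L_def by (auto intro!: bexI[of _ p])
      then have "coeff p n \<in> L i"
        using n0 by (auto simp: i_def min_def)
      then obtain q where q: "q \<in> ideal_hull G" "degree q \<le> i" "coeff q i = coeff p n"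
        using lead[of i] by (auto simp: i_def)
      define q' where "q' = monom 1 (n - i) * q"
      have q'G: "q' \<in> ideal_hull G"
        unfolding q'_def using q by (intro ideal_mult[OF ideal_hull_ideal])
      have "G \<subseteq> J"
        using P by (auto simp: G_def)
      then have "q' \<in> J"
        using q'G ideal_hull_least[OF J] by blast
      then have pq: "p - q' \<in> J"
        using p by (intro ideal_diff[OF J])
      have "i \<le> n"
        by (simp add: i_def)
      then have deg: "degree q' \<le> n"
        using degree_mult_le[of "monom 1 (n - i)" q] degree_monom_le[of "1::'a" "n - i"] q
        by (simp add: q'_def)
      have "coeff q' n = coeff p n"
        using q by (simp add: q'_def coeff_monom_mult i_def)
      then have zero: "coeff (p - q') m = 0" if "n \<le> m" for m
        using that p(2) deg by (cases "m = n") (auto simp: coeff_eq_0)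
      have "p - q' \<in> ideal_hull G"
      proof (cases "p - q' = 0")
        case True
        then show ?thesis
          using ideal_zero[OF ideal_hull_ideal] by simp
      next
        case False
        then have "degree (p - q') < n"
          using zero[of "degree (p - q')"] by (meson leading_coeff_0_iff not_le)
        then show ?thesis
          using Suc pq by blast
      qed
      then show "p \<in> ideal_hull G"
        using ideal_add[OF ideal_hull_ideal _ q'G] by fastforce
    qed
  qed simp
  then have "J \<subseteq> ideal_hull G"
    by blast
  moreover have "ideal_hull G \<subseteq> J"
    using P by (intro ideal_hull_least J) (auto simp: G_def)
  moreover have "finite G"
    using B by (auto simp: G_def)
  ultimately show "\<exists>B. finite B \<and> J = ideal_hull B"
    by blast
qed

text \<open>Noetherianity of the quotient by \<open>P\<close> without forming it. Ideals
  \<open>J\<close> not containing \<open>P\<close> are included because the intersection argument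
  applies this to \<open>J \<inter> P\<close> modulo a second ideal.\<close>

definition finitely_generated_modulo :: "'r::comm_ring_1 set \<Rightarrow> bool" where
  "finitely_generated_modulo P \<longleftrightarrow>
     (\<forall>J. is_ideal J \<longrightarrow> (\<exists>B. finite B \<and> B \<subseteq> J \<and> J \<subseteq> ideal_hull (B \<union> P)))"

lemma finitely_generated_moduloE:
  assumes "finitely_generated_modulo P" "is_ideal J"
  obtains B where "finite B" "B \<subseteq> J" "J \<subseteq> ideal_hull (B \<union> P)"
  using assms unfolding finitely_generated_modulo_def by meson

lemma finitely_generated_idealsE:
  fixes J :: "'r::comm_ring_1 set"
  assumes "finitely_generated_ideals TYPE('r)" "is_ideal J"
  obtains B where "finite B" "J = ideal_hull B"
  using assms unfolding finitely_generated_ideals_def by meson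

lemma ideal_plus:
  assumes "is_ideal J" "is_ideal P"
  shows "is_ideal {x. \<exists>j\<in>J. x - j \<in> P}"
proof (rule is_idealI)
  fix x y r
  assume x: "x \<in> {x. \<exists>j\<in>J. x - j \<in> P}"
  then obtain i where i: "i \<in> J" "x - i \<in> P"
    by blast
  show "r * x \<in> {x. \<exists>j\<in>J. x - j \<in> P}"
    using i ideal_mult[OF assms(1) i(1), of r] ideal_mult[OF assms(2) i(2), of r]
    by (auto simp: algebra_simps)
  assume "y \<in> {x. \<exists>j\<in>J. x - j \<in> P}"
  then obtain j where j: "j \<in> J" "y - j \<in> P"
    by blast
  show "x + y \<in> {x. \<exists>j\<in>J. x - j \<in> P}"
    using ideal_add[OF assms(1) i(1) j(1)] ideal_add[OF assms(2) i(2) j(2)]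
    by (auto simp: algebra_simps intro!: bexI[of _ "i + j"])
qed (use assms in \<open>auto intro!: bexI[of _ 0] simp: ideal_zero\<close>)

lemma ideal_hull_UnE:
  assumes "is_ideal P" "x \<in> ideal_hull (B \<union> P)"
  obtains b where "b \<in> ideal_hull B" "x - b \<in> P"
proof -
  have "B \<union> P \<subseteq> {x. \<exists>j\<in>ideal_hull B. x - j \<in> P}"
    using ideal_hull_superset[of B] ideal_zero[OF assms(1)] ideal_zero[OF ideal_hull_ideal, of B]
    by force
  from ideal_hull_least[OF ideal_plus[OF ideal_hull_ideal assms(1)] this]
  show thesis
    using assms(2) that by blast
qed

text \<open>Generators of the preimage of \<open>J + P\<close> are sent by \<open>f\<close> into
  \<open>J + P\<close>; correcting each by an element of \<open>P\<close> moves it into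
  \<open>J\<close>.\<close>

lemma finitely_generated_modulo_image:
  fixes f :: "'a::comm_ring_1 \<Rightarrow> 'r::comm_ring_1"
  assumes f: "ring_morphism f" and P: "is_ideal P"
    and noeth: "finitely_generated_ideals TYPE('a)" and surj: "\<And>p. \<exists>q. p - f q \<in> P"
  shows "finitely_generated_modulo P"
  unfolding finitely_generated_modulo_def
proof (intro allI impI)
  interpret ring_morphism f by fact
  fix J :: "'r set" assume J: "is_ideal J"
  obtain B0 where B0: "finite B0" "f -` {x. \<exists>j\<in>J. x - j \<in> P} = ideal_hull B0"
    by (rule finitely_generated_idealsE[OF noeth hom_vimage_ideal[OF ideal_plus[OF J P]]])
  have "B0 \<subseteq> f -` {x. \<exists>j\<in>J. x - j \<in> P}"
    unfolding B0(2) by (rule ideal_hull_superset)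
  then have "\<forall>b\<in>B0. \<exists>j. j \<in> J \<and> f b - j \<in> P"
    by auto
  from bchoice[OF this] obtain g where g: "\<And>b. b \<in> B0 \<Longrightarrow> g b \<in> J" "\<And>b. b \<in> B0 \<Longrightarrow> f b - g b \<in> P"
    by blast
  let ?H = "ideal_hull (g ` B0 \<union> P)"
  note H = ideal_hull_ideal[of "g ` B0 \<union> P"]
  have P_le: "P \<subseteq> ?H"
    using ideal_hull_superset[of "g ` B0 \<union> P"] by blast
  have "f b \<in> ?H" if b: "b \<in> B0" for b
  proof -
    have "g b \<in> ?H"
      using b ideal_hull_superset[of "g ` B0 \<union> P"] by blast
    then show ?thesis
      using ideal_diff_cancel[OF H] g(2)[OF b] P_le by blast
  qed
  then have hull: "ideal_hull B0 \<subseteq> f -` ?H"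
    by (intro ideal_hull_least hom_vimage_ideal H) auto
  have "J \<subseteq> ?H"
  proof
    fix p assume p: "p \<in> J"
    obtain q where q: "p - f q \<in> P"
      using surj by blast
    have "f q - p \<in> P"
      using ideal_uminus[OF P q] by simp
    then have "q \<in> ideal_hull B0"
      using p by (auto simp flip: B0(2))
    then show "p \<in> ?H"
      using hull ideal_diff_cancel[OF H, of p "f q"] q P_le by blast
  qed
  then show "\<exists>B. finite B \<and> B \<subseteq> J \<and> J \<subseteq> ideal_hull (B \<union> P)"
    using B0(1) g(1) by (intro exI[of _ "g ` B0"]) auto
qed

text \<open>Two stages: generators modulo \<open>P\<close> approximate an element of
  \<open>J\<close>, and the error lies in \<open>J \<inter> P\<close>, where generators modulo
  \<open>P'\<close> take over. These lie in \<open>P\<close> themselves, so the final error is in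
  both ideals.\<close>

lemma finitely_generated_modulo_Int:
  assumes P: "is_ideal P" "finitely_generated_modulo P"
    and P': "is_ideal P'" "finitely_generated_modulo P'"
  shows "finitely_generated_modulo (P \<inter> P')"
  unfolding finitely_generated_modulo_def
proof (intro allI impI)
  fix J :: "'a set" assume J: "is_ideal J"
  obtain B where B: "finite B" "B \<subseteq> J" "J \<subseteq> ideal_hull (B \<union> P)"
    by (rule finitely_generated_moduloE[OF P(2) J])
  obtain B' where B': "finite B'" "B' \<subseteq> J \<inter> P" "J \<inter> P \<subseteq> ideal_hull (B' \<union> P')"
    by (rule finitely_generated_moduloE[OF P'(2) ideal_Int[OF J P(1)]])
  let ?H = "ideal_hull (B \<union> B' \<union> P \<inter> P')"
  have "J \<subseteq> ?H"
  proof
    fix p assume p: "p \<in> J"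
    obtain b where b: "b \<in> ideal_hull B" "p - b \<in> P"
      using ideal_hull_UnE[OF P(1)] B(3) p by blast
    have "b \<in> J"
      using b(1) ideal_hull_least[OF J B(2)] by blast
    then have pb: "p - b \<in> J \<inter> P"
      using p b(2) ideal_diff[OF J] by blast
    then obtain b' where b': "b' \<in> ideal_hull B'" "p - b - b' \<in> P'"
      using ideal_hull_UnE[OF P'(1)] B'(3) by blast
    have "b' \<in> P"
      using b'(1) ideal_hull_least[OF P(1), of B'] B'(2) by blast
    then have "p - b - b' \<in> P \<inter> P'"
      using ideal_diff[OF P(1) b(2)] b'(2) by blast
    then have "p - b - b' \<in> ?H"
      using ideal_hull_superset[of "B \<union> B' \<union> P \<inter> P'"] by blast
    moreover have "b \<in> ?H" "b' \<in> ?H"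
      using b(1) b'(1) ideal_hull_mono[of B "B \<union> B' \<union> P \<inter> P'"] ideal_hull_mono[of B' "B \<union> B' \<union> P \<inter> P'"]
      by auto
    ultimately have "p - b - b' + b' + b \<in> ?H"
      using ideal_add[OF ideal_hull_ideal] by blast
    then show "p \<in> ?H"
      by simp
  qed
  then show "\<exists>B. finite B \<and> B \<subseteq> J \<and> J \<subseteq> ideal_hull (B \<union> P \<inter> P')"
    using B(1,2) B'(1,2) by (intro exI[of _ "B \<union> B'"]) auto
qed

lemma finitely_generated_modulo_INT:
  fixes P :: "'i \<Rightarrow> 'r::comm_ring_1 set"
  assumes "finite A" "\<And>F. F \<in> A \<Longrightarrow> is_ideal (P F)" "\<And>F. F \<in> A \<Longrightarrow> finitely_generated_modulo (P F)"
  shows "finitely_generated_modulo (\<Inter>F\<in>A. P F)"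
  using assms
proof (induction A)
  case empty
  have "ideal_hull UNIV = (UNIV :: 'r set)"
    using ideal_hull_superset[of UNIV] by blast
  then show ?case
    by (auto simp: finitely_generated_modulo_def)
next
  case (insert F A)
  have "is_ideal (\<Inter>F\<in>A. P F)"
    using insert.prems by (intro ideal_Inter) auto
  then show ?case
    using insert finitely_generated_modulo_Int[of "P F" "\<Inter>F\<in>A. P F"] by auto
qed

section \<open>Chains of primes and algebraic dependence\<close>

text \<open>Gaussian elimination: an equation with a nonzero coefficient at \<open>t0\<close> is
  solved for that unknown, which removes one equation and one unknown.\<close>

lemma homogeneous_system_solvable:
  fixes A :: "'s \<Rightarrow> 't \<Rightarrow> 'k::field"
  assumes "finite S" "finite T" "card S < card T"
  obtains c where "\<exists>t\<in>T. c t \<noteq> 0" "\<And>s. s \<in> S \<Longrightarrow> (\<Sum>t\<in>T. c t * A s t) = 0"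
proof -
  have "\<exists>c. (\<exists>t\<in>T. c t \<noteq> 0) \<and> (\<forall>s\<in>S. (\<Sum>t\<in>T. c t * A s t) = 0)"
    using assms
  proof (induction S arbitrary: T A)
    case empty
    then have "T \<noteq> {}"
      by auto
    then show ?case
      by (intro exI[of _ "\<lambda>_. 1"]) auto
  next
    case (insert s S)
    show ?case
    proof (cases "\<forall>t\<in>T. A s t = 0")
      case True
      have "card S < card T"
        using insert.prems insert.hyps by simp
      then obtain c where "\<exists>t\<in>T. c t \<noteq> 0" "\<forall>s\<in>S. (\<Sum>t\<in>T. c t * A s t) = 0"
        using insert.IH[OF insert.prems(1)] by metis
      then show ?thesis
        using True by (intro exI[of _ c]) auto
    next
      case False
      then obtain t0 where t0: "t0 \<in> T" "A s t0 \<noteq> 0"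
        by blast
      define T' where "T' = T - {t0}"
      have T: "T = insert t0 T'" "t0 \<notin> T'" "finite T'"
        using t0 insert.prems by (auto simp: T'_def)
      have "card S < card T'"
        using insert.prems insert.hyps T by simp
      then obtain c where c: "\<exists>t\<in>T'. c t \<noteq> 0"
        and sol: "\<forall>s'\<in>S. (\<Sum>t\<in>T'. c t * (A s' t - A s' t0 * A s t / A s t0)) = 0"
        using insert.IH[OF T(3), of "\<lambda>s' t. A s' t - A s' t0 * A s t / A s t0"] by metis
      define c' where "c' = c(t0 := - (\<Sum>t\<in>T'. c t * A s t) / A s t0)"
      have sum: "(\<Sum>t\<in>T. c' t * A s' t) = (\<Sum>t\<in>T'. c t * (A s' t - A s' t0 * A s t / A s t0))" for s'
      proof -
        have "(\<Sum>t\<in>T'. c' t * A s' t) = (\<Sum>t\<in>T'. c t * A s' t)"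
          using T by (intro sum.cong) (auto simp: c'_def)
        moreover have "c' t0 * A s' t0 = - (\<Sum>t\<in>T'. c t * (A s' t0 * A s t / A s t0))"
          by (simp add: c'_def sum_distrib_left sum_distrib_right sum_divide_distrib mult_ac
              flip: sum_negf)
        ultimately show ?thesis
          using T by (simp add: right_diff_distrib sum_subtractf)
      qed
      have "(\<Sum>t\<in>T. c' t * A s t) = 0"
        using t0 by (simp add: sum)
      moreover have "\<exists>t\<in>T. c' t \<noteq> 0"
        using c T by (auto simp: c'_def)
      ultimately show ?thesis
        using sol by (intro exI[of _ c']) (auto simp: sum)
    qed
  qed
  then show thesis
    using that by blast
qed

text \<open>Exponents are lists: dropping the first variable matches passing from \<open>Q 0\<close>
  to \<open>Q 1\<close>, and bounded exponents are counted as lists of fixed length.\<close>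

fun monomial_value :: "'r::comm_ring_1 list \<Rightarrow> nat list \<Rightarrow> 'r" where
  "monomial_value (x # xs) (n # ns) = x ^ n * monomial_value xs ns"
| "monomial_value _ _ = 1"

text \<open>
  Divide the sum by the least power of the first variable that occurs, pass to the next prime,
  where only the terms with that least power survive, and repeat.
\<close>

lemma prime_chain_witnesses_independent:
  assumes "\<And>i. i \<le> length xs \<Longrightarrow> is_prime (Q i)" "\<And>i. i < length xs \<Longrightarrow> Q i \<subseteq> Q (Suc i)"
    and "\<And>i. i < length xs \<Longrightarrow> xs ! i \<in> Q (Suc i) - Q i"
    and "finite T" "T \<noteq> {}" "\<And>e. e \<in> T \<Longrightarrow> length e = length xs"
    and "\<And>e. e \<in> T \<Longrightarrow> u e \<notin> Q (length xs)"
  shows "(\<Sum>e\<in>T. u e * monomial_value xs e) \<notin> Q 0"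
  using assms
proof (induction xs arbitrary: Q T u)
  case Nil
  then have "T = {[]}"
    by fastforce
  then show ?case
    using Nil by simp
next
  case (Cons x xs)
  define a where "a = Min (hd ` T)"
  define T1 where "T1 = {e \<in> T. hd e = a}"
  have ne: "e = hd e # tl e" if "e \<in> T" for e
    using Cons.prems(6)[OF that] by (cases e) auto
  have a_le: "a \<le> hd e" if "e \<in> T" for e
    using that Cons.prems(4) by (auto simp: a_def)
  have "a \<in> hd ` T"
    using Cons.prems(4,5) unfolding a_def by (intro Min_in) auto
  then have T1: "T1 \<noteq> {}" "T1 \<subseteq> T" "finite T1"
    using Cons.prems(4) by (auto simp: T1_def)
  define A where "A = (\<Sum>e\<in>T1. u e * monomial_value xs (tl e))"
  define B where "B = (\<Sum>e\<in>T-T1. u e * (x ^ (hd e - Suc a) * monomial_value xs (tl e)))"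
  have Q0: "is_prime (Q 0)" and Q1: "is_prime (Q 1)" and Q01: "Q 0 \<subseteq> Q 1" and x: "x \<in> Q 1" "x \<notin> Q 0"
    using Cons.prems(1)[of 0] Cons.prems(1)[of 1] Cons.prems(2)[of 0] Cons.prems(3)[of 0] by auto
  have "(\<Sum>e\<in>T1. u e * monomial_value (x # xs) e) = x ^ a * A"
    unfolding A_def sum_distrib_left
  proof (rule sum.cong)
    fix e assume "e \<in> T1"
    then have "e = a # tl e"
      using ne by (auto simp: T1_def)
    then show "u e * monomial_value (x # xs) e = x ^ a * (u e * monomial_value xs (tl e))"
      by (metis monomial_value.simps(1) mult.left_commute)
  qed simp
  moreover have "(\<Sum>e\<in>T-T1. u e * monomial_value (x # xs) e) = x ^ a * (x * B)"
    unfolding B_def sum_distrib_left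
  proof (rule sum.cong)
    fix e assume e: "e \<in> T - T1"
    then have "Suc a \<le> hd e"
      using a_le[of e] by (auto simp: T1_def)
    then have "x ^ hd e = x ^ a * (x * x ^ (hd e - Suc a))"
      by (metis le_add_diff_inverse mult.assoc power_Suc2 power_add)
    moreover have "monomial_value (x # xs) e = x ^ hd e * monomial_value xs (tl e)"
      using ne[of e] e by (metis DiffD1 monomial_value.simps(1))
    ultimately show "u e * monomial_value (x # xs) e
        = x ^ a * (x * (u e * (x ^ (hd e - Suc a) * monomial_value xs (tl e))))"
      by (simp add: mult_ac)
  qed simp
  ultimately have split: "(\<Sum>e\<in>T. u e * monomial_value (x # xs) e) = x ^ a * (A + x * B)"
    using T1 Cons.prems(4) by (simp add: sum.subset_diff[of T1 T] algebra_simps)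
  have inj: "inj_on tl T1"
    using ne T1(2) unfolding inj_on_def T1_def by (metis (mono_tags, lifting) in_mono mem_Collect_eq)
  have "A = (\<Sum>e\<in>tl ` T1. u (a # e) * monomial_value xs e)"
    unfolding A_def sum.reindex[OF inj]
    using ne by (intro sum.cong) (auto simp: T1_def)
  also have "\<dots> \<notin> Q (Suc 0)"
  \<comment> \<open>The chain is shifted because \<open>x\<close> vanishes modulo
    \<open>Q 1\<close>. On \<open>T1\<close> the first exponent is constantly \<open>a\<close>, so
    the tails still distinguish the terms.\<close>
  proof (rule Cons.IH[of "\<lambda>i. Q (Suc i)"])
    fix e assume "e \<in> tl ` T1"
    then obtain e' where e': "e' \<in> T1" "e = tl e'"
      by blast
    then have "e' = a # e"
      using ne by (auto simp: T1_def)
    then have "a # e \<in> T"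
      using e' T1 by auto
    then show "length e = length xs" "u (a # e) \<notin> Q (Suc (length xs))"
      using Cons.prems(6,7) by fastforce+
  next
    fix i assume "i < length xs"
    then show "Q (Suc i) \<subseteq> Q (Suc (Suc i))" "xs ! i \<in> Q (Suc (Suc i)) - Q (Suc i)"
      using Cons.prems(2)[of "Suc i"] Cons.prems(3)[of "Suc i"] by auto
  qed (use Cons.prems(1) T1 in auto)
  finally have A: "A \<notin> Q 1"
    by simp
  show ?case
  proof
    assume "(\<Sum>e\<in>T. u e * monomial_value (x # xs) e) \<in> Q 0"
    then have "A + x * B \<in> Q 0"
      using prime_mult[OF Q0] prime_power[OF Q0] x(2) unfolding split by blast
    then have "A + x * B - B * x \<in> Q 1"
      using Q01 x(1) by (intro ideal_diff ideal_mult prime_ideal[OF Q1]) auto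
    then show False
      using A by (simp add: mult.commute)
  qed
qed

section \<open>Polynomials in several variables\<close>

abbreviation lookup where "lookup \<equiv> Poly_Mapping.lookup"
abbreviation keys where "keys \<equiv> Poly_Mapping.keys"
abbreviation single where "single \<equiv> Poly_Mapping.single"

type_synonym ('v, 'k) mpoly = "('v \<Rightarrow>\<^sub>0 nat) \<Rightarrow>\<^sub>0 'k"

lemma keys_plus_nat: "keys (m + n) = keys m \<union> keys n" for m n :: "'v \<Rightarrow>\<^sub>0 nat"
  by (auto simp: in_keys_iff lookup_add)

lemma mpoly_sum_monomials: "p = (\<Sum>m\<in>keys p. single m (lookup p m))"
proof (rule poly_mapping_eqI)
  fix n
  have "lookup (\<Sum>m\<in>keys p. single m (lookup p m)) n = (\<Sum>m\<in>keys p. if m = n then lookup p m else 0)"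
    by (simp add: lookup_sum lookup_single when_def)
  also have "\<dots> = lookup p n"
    by (simp add: sum.delta in_keys_iff)
  finally show "lookup p n = lookup (\<Sum>m\<in>keys p. single m (lookup p m)) n"
    by simp
qed

lemma mpoly_monomial_induct [case_names monomial add]:
  fixes p :: "'m \<Rightarrow>\<^sub>0 'k::comm_monoid_add"
  assumes single: "\<And>m c. P (single m c)" and add: "\<And>p q. P p \<Longrightarrow> P q \<Longrightarrow> P (p + q)"
  shows "P p"
proof -
  have "P (\<Sum>m\<in>A. single m (lookup p m))" for A
    by (induction A rule: infinite_finite_induct) (use single[of undefined 0] in \<open>auto intro: assms\<close>)
  then show ?thesis
    by (subst mpoly_sum_monomials)
qed

lemma mpoly_var_power: "mpoly_var v ^ n = (single (single v n) 1 :: ('v, 'k::field) mpoly)"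
  by (induction n) (auto simp: mpoly_var_def mult_single simp flip: single_add)

lemma monomial_eq_prod:
  "single m c = single 0 c * (\<Prod>v\<in>keys m. mpoly_var v ^ lookup m v)"
  for c :: "'k::field" and m :: "'v \<Rightarrow>\<^sub>0 nat"
proof -
  have "(\<Prod>v\<in>A. mpoly_var v ^ lookup m v) = (single (\<Sum>v\<in>A. single v (lookup m v)) 1 :: ('v, 'k) mpoly)" for A
    by (induction A rule: infinite_finite_induct) (auto simp: mpoly_var_power mult_single)
  then show ?thesis
    by (simp add: mult_single flip: mpoly_sum_monomials)
qed

lemma mpoly_induct [case_names const var add mult]:
  fixes p :: "('v, 'k::field) mpoly"
  assumes const: "\<And>c. P (single 0 c)" and var: "\<And>v. P (mpoly_var v)"
    and add: "\<And>p q. P p \<Longrightarrow> P q \<Longrightarrow> P (p + q)" and mult: "\<And>p q. P p \<Longrightarrow> P q \<Longrightarrow> P (p * q)"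
  shows "P p"
proof (induction p rule: mpoly_monomial_induct)
  case (monomial m c)
  have one: "P 1"
    using const[of 1] by simp
  then have "P (mpoly_var v ^ n)" for v n
    by (induction n) (auto intro: mult var)
  then have "P (\<Prod>v\<in>A. mpoly_var v ^ lookup m v)" for A
    by (induction A rule: infinite_finite_induct) (auto intro: mult one)
  then show ?case
    unfolding monomial_eq_prod[of m c] by (intro mult const)
qed (rule add)

lemma const_morphism: "ring_morphism (single 0 :: 'k::field \<Rightarrow> ('v, 'k) mpoly)"
  by standard (auto simp: single_add mult_single)

lemma ring_morphism_monomialI:
  fixes f :: "('v, 'k::field) mpoly \<Rightarrow> 'b::comm_ring_1"
  assumes add: "\<And>p q. f (p + q) = f p + f q" and one: "f 1 = 1"
    and mult: "\<And>m n a b. f (single m a * single n b) = f (single m a) * f (single n b)"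
  shows "ring_morphism f"
proof
  fix p q
  have "f (single m a * q) = f (single m a) * f q" for m a
    by (induction q rule: mpoly_monomial_induct) (auto simp: distrib_left add mult)
  then show "f (p * q) = f p * f q"
    by (induction p rule: mpoly_monomial_induct) (auto simp: distrib_right add)
qed (fact add one)+

subsection \<open>Evaluation\<close>

definition meval :: "('k \<Rightarrow> 'b) \<Rightarrow> ('v \<Rightarrow> 'b) \<Rightarrow> ('v, 'k::field) mpoly \<Rightarrow> 'b::comm_ring_1" where
  "meval \<phi> g p = (\<Sum>m\<in>keys p. \<phi> (lookup p m) * (\<Prod>v\<in>keys m. g v ^ lookup m v))"

context
  fixes \<phi> :: "'k::field \<Rightarrow> 'b::comm_ring_1" and g :: "'v \<Rightarrow> 'b"
  assumes \<phi>: "ring_morphism \<phi>"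
begin

interpretation \<phi>: ring_morphism \<phi>
  by (rule \<phi>)

lemma meval_superset:
  assumes "finite A" "keys p \<subseteq> A"
  shows "meval \<phi> g p = (\<Sum>m\<in>A. \<phi> (lookup p m) * (\<Prod>v\<in>keys m. g v ^ lookup m v))"
  unfolding meval_def using assms
  by (intro sum.mono_neutral_left) (auto simp: in_keys_iff \<phi>.hom_zero)

lemma meval_single: "meval \<phi> g (single m c) = \<phi> c * (\<Prod>v\<in>keys m. g v ^ lookup m v)"
  by (subst meval_superset[of "{m}"]) auto

lemma meval_add: "meval \<phi> g (p + q) = meval \<phi> g p + meval \<phi> g q"
proof -
  have "finite (keys p \<union> keys q)" "keys (p + q) \<subseteq> keys p \<union> keys q"
    using keys_add[of p q] by auto
  then show ?thesis
    by (simp add: meval_superset[of "keys p \<union> keys q"] lookup_add \<phi>.hom_add distrib_right sum.distrib)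
qed

lemma meval_morphism: "ring_morphism (meval \<phi> g)"
proof (rule ring_morphism_monomialI)
  show "meval \<phi> g 1 = 1"
    using meval_single[of 0 1] by (simp add: \<phi>.hom_one)
  fix m n :: "'v \<Rightarrow>\<^sub>0 nat" and a b
  have sup: "(\<Prod>v\<in>keys m'. g v ^ lookup m' v) = (\<Prod>v\<in>keys m \<union> keys n. g v ^ lookup m' v)"
    if "keys m' \<subseteq> keys m \<union> keys n" for m'
    using that by (intro prod.mono_neutral_left) (auto simp: in_keys_iff)
  show "meval \<phi> g (single m a * single n b) = meval \<phi> g (single m a) * meval \<phi> g (single n b)"
    by (simp add: mult_single meval_single sup keys_plus_nat \<phi>.hom_mult lookup_add power_add
        prod.distrib mult_ac)
qed (rule meval_add)

lemma meval_const: "meval \<phi> g (single 0 c) = \<phi> c"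
  by (simp add: meval_single)

lemma meval_var: "meval \<phi> g (mpoly_var v) = g v"
  by (simp add: mpoly_var_def meval_single \<phi>.hom_one)

end

lemma mpoly_morphism_eqI:
  fixes f g :: "('v, 'k::field) mpoly \<Rightarrow> 'b::comm_ring_1"
  assumes "ring_morphism f" "ring_morphism g" "\<And>c. f (single 0 c) = g (single 0 c)"
    "\<And>v. f (mpoly_var v) = g (mpoly_var v)"
  shows "f p = g p"
  by (induction p rule: mpoly_induct)
    (use assms in \<open>auto simp: ring_morphism.hom_add ring_morphism.hom_mult\<close>)

subsection \<open>Restriction to a set of variables\<close>

text \<open>Sets the variables outside \<open>F\<close> to zero. For a face this is the restriction
  from the Stanley-Reisner ring to the polynomial ring of the face.\<close>

lift_definition restrict_vars :: "'v set \<Rightarrow> ('v, 'k::field) mpoly \<Rightarrow> ('v, 'k) mpoly"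
  is "\<lambda>F p m. if keys m \<subseteq> F then p m else 0"
  by (rule finite_subset) auto

lemma lookup_restrict_vars: "lookup (restrict_vars F p) m = (if keys m \<subseteq> F then lookup p m else 0)"
  by transfer simp

lemma restrict_vars_single:
  "restrict_vars F (single m c) = (if keys m \<subseteq> F then single m c else 0)"
  by (rule poly_mapping_eqI) (auto simp: lookup_restrict_vars lookup_single when_def)

lemma restrict_vars_morphism: "ring_morphism (restrict_vars F)"
proof (rule ring_morphism_monomialI)
  show "restrict_vars F (p + q) = restrict_vars F p + restrict_vars F q" for p q
    by (rule poly_mapping_eqI) (simp add: lookup_restrict_vars lookup_add)
  show "restrict_vars F 1 = 1"
    using restrict_vars_single[of F 0 1] by simp
qed (simp add: mult_single restrict_vars_single keys_plus_nat)

lemma restrict_vars_const: "restrict_vars F (single 0 c) = single 0 c"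
  by (simp add: restrict_vars_single)

lemma restrict_vars_var: "restrict_vars F (mpoly_var v) = (if v \<in> F then mpoly_var v else 0)"
  by (simp add: mpoly_var_def restrict_vars_single)

lemma restrict_vars_restrict_vars: "restrict_vars F (restrict_vars G p) = restrict_vars (F \<inter> G) p"
  by (rule poly_mapping_eqI) (auto simp: lookup_restrict_vars)

lemma restrict_vars_eq_iff: "restrict_vars F p = p \<longleftrightarrow> (\<forall>m\<in>keys p. keys m \<subseteq> F)"
  by (auto simp: poly_mapping_eq_iff fun_eq_iff lookup_restrict_vars in_keys_iff)

subsection \<open>Stanley-Reisner ideals\<close>

text \<open>The Stanley-Reisner ideal in the polynomial ring on the whole type. It also contains the
  variables that are no vertices, so the quotient is the same ring.\<close>

definition nonface_ideal :: "'v set set \<Rightarrow> ('v, 'k::field) mpoly set" where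
  "nonface_ideal \<Delta> = {p. \<forall>m\<in>keys p. keys m \<notin> \<Delta>}"

definition kernel_ideal :: "'v set \<Rightarrow> ('v, 'k::field) mpoly set" where
  "kernel_ideal F = {p. restrict_vars F p = 0}"

lemma kernel_ideal_ideal: "is_ideal (kernel_ideal F :: ('v, 'k::field) mpoly set)"
proof -
  interpret ring_morphism "restrict_vars F :: ('v, 'k) mpoly \<Rightarrow> _"
    by (rule restrict_vars_morphism)
  have "is_ideal {0 :: ('v, 'k) mpoly}"
    by (simp add: is_ideal_def)
  from hom_vimage_ideal[OF this] show ?thesis
    by (simp add: kernel_ideal_def vimage_def)
qed

locale simplicial_complex =
  fixes \<Delta> :: "'a set set"
  assumes finite_complex: "finite \<Delta>"
    and finite_face: "F \<in> \<Delta> \<Longrightarrow> finite F"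
    and subface: "F \<in> \<Delta> \<Longrightarrow> G \<subseteq> F \<Longrightarrow> G \<in> \<Delta>"
begin

text \<open>A monomial supported on a face survives restriction to its own support. This is the
  decomposition of the Stanley-Reisner ideal into the face primes.\<close>

lemma nonface_ideal_eq: "(nonface_ideal \<Delta> :: ('a, 'k::field) mpoly set) = (\<Inter>F\<in>\<Delta>. kernel_ideal F)"
proof (intro equalityI subsetI)
  fix p :: "('a, 'k) mpoly"
  assume p: "p \<in> nonface_ideal \<Delta>"
  have "lookup (restrict_vars F p) m = 0" if F: "F \<in> \<Delta>" for F m
    using p subface[OF F] by (simp add: lookup_restrict_vars nonface_ideal_def) (meson in_keys_iff)
  then show "p \<in> (\<Inter>F\<in>\<Delta>. kernel_ideal F)"
    by (auto simp: kernel_ideal_def intro: poly_mapping_eqI)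
next
  fix p :: "('a, 'k) mpoly"
  assume p: "p \<in> (\<Inter>F\<in>\<Delta>. kernel_ideal F)"
  have "keys m \<notin> \<Delta>" if "m \<in> keys p" for m
  proof
    assume "keys m \<in> \<Delta>"
    then have "restrict_vars (keys m) p = 0"
      using p by (auto simp: kernel_ideal_def)
    then have "lookup (restrict_vars (keys m) p) m = 0"
      by simp
    then show False
      using that by (simp add: lookup_restrict_vars in_keys_iff)
  qed
  then show "p \<in> nonface_ideal \<Delta>"
    by (simp add: nonface_ideal_def)
qed

lemma nonface_ideal_ideal: "is_ideal (nonface_ideal \<Delta>)"
  unfolding nonface_ideal_eq by (rule ideal_Inter) (auto intro: kernel_ideal_ideal)

end

section \<open>The Stanley-Reisner ring as a quotient of the full polynomial ring\<close>

lemma mpoly_ring_simps: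
  "carrier (mpoly_ring W) = {p. restrict_vars W p = p}"
  "mult (mpoly_ring W) = (*)" "one (mpoly_ring W) = 1" "zero (mpoly_ring W) = 0" "add (mpoly_ring W) = (+)"
  by (auto simp: mpoly_ring_def restrict_vars_eq_iff)

lemma mpoly_ring_cring: "cring (mpoly_ring W :: (('v \<Rightarrow>\<^sub>0 nat) \<Rightarrow>\<^sub>0 'k::field) ring)"
proof -
  interpret ring_morphism "restrict_vars W :: ('v, 'k) mpoly \<Rightarrow> _"
    by (rule restrict_vars_morphism)
  show ?thesis
  proof (rule cringI)
    show "abelian_group (mpoly_ring W :: (('v \<Rightarrow>\<^sub>0 nat) \<Rightarrow>\<^sub>0 'k) ring)"
    proof (rule abelian_groupI)
      fix p :: "('v, 'k) mpoly" assume "p \<in> carrier (mpoly_ring W)"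
      then show "\<exists>q\<in>carrier (mpoly_ring W). q \<oplus>\<^bsub>mpoly_ring W\<^esub> p = \<zero>\<^bsub>mpoly_ring W\<^esub>"
        by (intro bexI[of _ "- p"]) (auto simp: mpoly_ring_simps hom_uminus)
    qed (auto simp: mpoly_ring_simps hom_add hom_zero add_ac)
    show "comm_monoid (mpoly_ring W :: (('v \<Rightarrow>\<^sub>0 nat) \<Rightarrow>\<^sub>0 'k) ring)"
      by (rule comm_monoidI) (auto simp: mpoly_ring_simps hom_mult hom_one mult_ac)
  qed (auto simp: mpoly_ring_simps distrib_right)
qed

definition squarefree_exponent :: "'v set \<Rightarrow> 'v \<Rightarrow>\<^sub>0 nat" where
  "squarefree_exponent F = (\<Sum>v\<in>F. single v 1)"

lemma lookup_squarefree_exponent: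
  "finite F \<Longrightarrow> lookup (squarefree_exponent F) u = (if u \<in> F then 1 else 0)"
  by (simp add: squarefree_exponent_def lookup_sum lookup_single when_def)

lemma keys_squarefree_exponent: "finite F \<Longrightarrow> keys (squarefree_exponent F) = F"
  by (auto simp: in_keys_iff lookup_squarefree_exponent split: if_splits)

lemma prod_mpoly_var: "(\<Prod>v\<in>F. mpoly_var v) = (single (squarefree_exponent F) 1 :: ('v, 'k::field) mpoly)"
  by (induction F rule: infinite_finite_induct)
    (auto simp: squarefree_exponent_def mpoly_var_def mult_single)

context simplicial_complex
begin

text \<open>A monomial with nonface support is a multiple of the squarefree monomial on that
  support, which is one of the generators.\<close>

lemma stanley_reisner_ideal_eq:
  "(stanley_reisner_ideal \<Delta> :: ('a, 'k::field) mpoly set) = nonface_ideal \<Delta> \<inter> carrier (mpoly_ring (\<Union>\<Delta>))"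
proof -
  define S where "S = (mpoly_ring (\<Union>\<Delta>) :: (('a \<Rightarrow>\<^sub>0 nat) \<Rightarrow>\<^sub>0 'k) ring)"
  define N where "N = (nonface_ideal \<Delta> :: ('a, 'k) mpoly set)"
  define gens where "gens = {\<Prod>v\<in>F. mpoly_var v :: ('a, 'k) mpoly | F. finite F \<and> F \<subseteq> \<Union>\<Delta> \<and> F \<notin> \<Delta>}"
  interpret cring S
    unfolding S_def by (rule mpoly_ring_cring)
  have S_simps: "carrier S = {p. restrict_vars (\<Union>\<Delta>) p = p}" "mult S = (*)" "one S = 1" "zero S = 0" "add S = (+)"
    by (simp_all add: S_def mpoly_ring_simps)
  interpret \<rho>: ring_morphism "restrict_vars (\<Union>\<Delta>) :: ('a, 'k) mpoly \<Rightarrow> _"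
    by (rule restrict_vars_morphism)
  have N: "is_ideal N"
    unfolding N_def by (rule nonface_ideal_ideal)
  have "ideal (N \<inter> carrier S) S"
  proof (rule idealI[OF ring_axioms])
    show "subgroup (N \<inter> carrier S) (add_monoid S)"
    proof (rule add.subgroupI)
      fix p assume p: "p \<in> N \<inter> carrier S"
      then have "\<ominus>\<^bsub>S\<^esub> p = - p"
        by (intro minus_equality) (auto simp: S_simps \<rho>.hom_uminus)
      then show "\<ominus>\<^bsub>S\<^esub> p \<in> N \<inter> carrier S"
        using p ideal_uminus[OF N] by (auto simp: S_simps \<rho>.hom_uminus)
    qed (use N in \<open>auto simp: S_simps \<rho>.hom_add ideal_add dest: ideal_zero intro!: \<rho>.hom_zero\<close>)
  qed (use N in \<open>auto simp: S_simps \<rho>.hom_mult intro: ideal_mult ideal_mult_right\<close>)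
  moreover have "gens \<subseteq> N \<inter> carrier S"
    by (auto simp: gens_def N_def nonface_ideal_def S_simps prod_mpoly_var keys_squarefree_exponent
        restrict_vars_eq_iff)
  ultimately have sub: "Idl\<^bsub>S\<^esub> gens \<subseteq> N \<inter> carrier S"
    by (rule genideal_minimal)
  have gens_S: "gens \<subseteq> carrier S"
    using \<open>gens \<subseteq> N \<inter> carrier S\<close> by blast
  interpret I: ideal "Idl\<^bsub>S\<^esub> gens" S
    by (rule genideal_ideal[OF gens_S])
  have "p \<in> Idl\<^bsub>S\<^esub> gens" if p: "p \<in> N \<inter> carrier S" for p
  proof -
    have mono: "single m c \<in> Idl\<^bsub>S\<^esub> gens" if m: "m \<in> keys p" for m c
    proof -
      define s where "s = squarefree_exponent (keys m)"
      have m_sub: "keys m \<subseteq> \<Union>\<Delta>" and "keys m \<notin> \<Delta>"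
        using p m by (auto simp: N_def nonface_ideal_def S_simps restrict_vars_eq_iff)
      then have "single s 1 \<in> gens"
        unfolding gens_def s_def by (auto simp: prod_mpoly_var[symmetric] intro!: exI[of _ "keys m"])
      then have "single s 1 \<in> Idl\<^bsub>S\<^esub> gens"
        using genideal_self[OF gens_S] by blast
      moreover have ms: "(m - s) + s = m"
        by (rule poly_mapping_eqI)
          (auto simp: lookup_add lookup_minus s_def lookup_squarefree_exponent in_keys_iff)
      have "keys (m - s) \<subseteq> \<Union>\<Delta>"
        using m_sub keys_plus_nat[of "m - s" s] by (auto simp: ms)
      then have "single (m - s) c \<in> carrier S"
        by (simp add: S_simps restrict_vars_single)
      ultimately have "single (m - s) c * single s 1 \<in> Idl\<^bsub>S\<^esub> gens"
        using I.I_l_closed[of "single s 1" "single (m - s) c"] by (simp add: S_simps)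
      then show ?thesis
        by (simp add: mult_single ms)
    qed
    have "(\<Sum>m\<in>A. single m (lookup p m)) \<in> Idl\<^bsub>S\<^esub> gens" if "A \<subseteq> keys p" for A
      using that
    proof (induction A rule: infinite_finite_induct)
      case (insert m A)
      then show ?case
        using I.a_closed[OF mono[of m "lookup p m"]] by (auto simp: S_simps)
    qed (use I.zero_closed in \<open>auto simp: S_simps\<close>)
    then show ?thesis
      by (subst mpoly_sum_monomials) auto
  qed
  then have "Idl\<^bsub>S\<^esub> gens = N \<inter> carrier S"
    using sub by blast
  then show ?thesis
    unfolding stanley_reisner_ideal_def S_def N_def gens_def by simp
qed

text \<open>Killing the variables that are no vertices before taking the coset makes the
  presentation total on the type.\<close>

definition sr_map :: "('a, 'k::field) mpoly \<Rightarrow> ('a, 'k) mpoly set" where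
  "sr_map p = stanley_reisner_ideal \<Delta> +>\<^bsub>mpoly_ring (\<Union>\<Delta>)\<^esub> restrict_vars (\<Union>\<Delta>) p"

lemma stanley_reisner_ring_presented:
  "presented_ring (stanley_reisner_ring TYPE('k::field) \<Delta>) sr_map" (is ?presented)
  "presented_ring.Ker (stanley_reisner_ring TYPE('k) \<Delta>) sr_map = nonface_ideal \<Delta>" (is ?kernel)
proof -
  define S where "S = (mpoly_ring (\<Union>\<Delta>) :: (('a \<Rightarrow>\<^sub>0 nat) \<Rightarrow>\<^sub>0 'k) ring)"
  define I where "I = (stanley_reisner_ideal \<Delta> :: ('a, 'k) mpoly set)"
  define \<rho> where "\<rho> = (restrict_vars (\<Union>\<Delta>) :: ('a, 'k) mpoly \<Rightarrow> ('a, 'k) mpoly)"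
  interpret S: cring S
    unfolding S_def by (rule mpoly_ring_cring)
  interpret \<rho>: ring_morphism \<rho>
    unfolding \<rho>_def by (rule restrict_vars_morphism)
  have S_simps: "carrier S = {p. \<rho> p = p}" "mult S = (*)" "one S = 1" "zero S = 0" "add S = (+)"
    by (simp_all add: S_def \<rho>_def mpoly_ring_simps)
  have \<rho>_S: "\<rho> p \<in> carrier S" for p
    by (simp add: S_simps \<rho>_def restrict_vars_restrict_vars)
  have I_eq: "I = nonface_ideal \<Delta> \<inter> carrier S"
    unfolding I_def S_def by (rule stanley_reisner_ideal_eq)
  interpret I: ideal I S
    unfolding I_def stanley_reisner_ideal_def S_def[symmetric]
    by (rule S.genideal_ideal)
      (auto simp: S_simps prod_mpoly_var keys_squarefree_exponent restrict_vars_eq_iff \<rho>_def)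
  have R: "stanley_reisner_ring TYPE('k) \<Delta> = S Quot I"
    by (simp add: stanley_reisner_ring_def S_def I_def)
  have sr: "sr_map p = I +>\<^bsub>S\<^esub> \<rho> p" for p :: "('a, 'k) mpoly"
    by (simp add: sr_map_def S_def I_def \<rho>_def)
  interpret Q: cring "S Quot I"
    by (rule I.quotient_is_cring[OF S.is_cring])
  note hom = I.rcos_ring_hom
  have carrier_Q: "carrier (S Quot I) = (\<lambda>p. I +>\<^bsub>S\<^esub> p) ` carrier S"
    by (auto simp: FactRing_def A_RCOSETS_def')
  show P: ?presented
    unfolding R
  proof unfold_locales
    fix p q
    show "sr_map (p + q) = sr_map p \<oplus>\<^bsub>S Quot I\<^esub> sr_map q"
      using ring_hom_add[OF hom \<rho>_S[of p] \<rho>_S[of q]] by (simp add: sr S_simps \<rho>.hom_add)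
    show "sr_map (p * q) = sr_map p \<otimes>\<^bsub>S Quot I\<^esub> sr_map q"
      using ring_hom_mult[OF hom \<rho>_S[of p] \<rho>_S[of q]] by (simp add: sr S_simps \<rho>.hom_mult)
  next
    show "sr_map 1 = \<one>\<^bsub>S Quot I\<^esub>"
      using ring_hom_one[OF hom] by (simp add: sr S_simps \<rho>.hom_one)
  next
    show "range sr_map = carrier (S Quot I)"
    proof
      show "range sr_map \<subseteq> carrier (S Quot I)"
        using \<rho>_S by (auto simp: carrier_Q sr)
      show "carrier (S Quot I) \<subseteq> range sr_map"
      proof
        fix x assume "x \<in> carrier (S Quot I)"
        then obtain p where "x = I +>\<^bsub>S\<^esub> p" "\<rho> p = p"
          by (auto simp: carrier_Q S_simps)
        then have "x = sr_map p"
          by (simp add: sr)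
        then show "x \<in> range sr_map"
          by blast
      qed
    qed
  qed
  have "sr_map p = \<zero>\<^bsub>S Quot I\<^esub> \<longleftrightarrow> p \<in> nonface_ideal \<Delta>" for p :: "('a, 'k) mpoly"
  proof -
    have "sr_map p = \<zero>\<^bsub>S Quot I\<^esub> \<longleftrightarrow> \<rho> p \<in> I"
      using I.rcos_const_imp_mem[OF \<rho>_S] S.a_rcos_zero[OF I.is_ideal] by (auto simp: sr FactRing_def)
    also have "\<dots> \<longleftrightarrow> \<rho> p \<in> nonface_ideal \<Delta>"
      using \<rho>_S by (simp add: I_eq)
    also have "\<dots> \<longleftrightarrow> p \<in> nonface_ideal \<Delta>"
    proof -
      \<comment> \<open>Faces consist of vertices, so discarding the other variables changes no
        restriction to a face.\<close>
      have "F \<in> \<Delta> \<Longrightarrow> restrict_vars F (\<rho> p) = restrict_vars F p" for F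
        by (simp add: \<rho>_def restrict_vars_restrict_vars Int_absorb2 Union_upper)
      then show ?thesis
        by (simp add: nonface_ideal_eq kernel_ideal_def)
    qed
    finally show ?thesis .
  qed
  then show ?kernel
    using presented_ring.Ker_def[OF P] by (auto simp: R)
qed

lemma cohen_macaulay_complexI:
  assumes "\<And>J :: ('a, 'k::field) mpoly set. is_ideal J \<Longrightarrow> nonface_ideal \<Delta> \<subseteq> J \<Longrightarrow>
      \<exists>B. finite B \<and> J = ideal_hull (B \<union> nonface_ideal \<Delta>)"
    and "\<And>Q :: nat \<Rightarrow> ('a, 'k) mpoly set. (\<And>i. i \<le> Suc d \<Longrightarrow> is_prime (Q i)) \<Longrightarrow>
      (\<And>i. i \<le> d \<Longrightarrow> Q i \<subset> Q (Suc i)) \<Longrightarrow> nonface_ideal \<Delta> \<subseteq> Q 0 \<Longrightarrow> False"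
    and "\<And>M :: ('a, 'k) mpoly set. is_maximal M \<Longrightarrow> nonface_ideal \<Delta> \<subseteq> M \<Longrightarrow>
      \<exists>xs. length xs = d \<and> set xs \<subseteq> M \<and> regular_modulo (nonface_ideal \<Delta>) xs"
  shows "cohen_macaulay_complex TYPE('k) \<Delta>"
  unfolding cohen_macaulay_complex_def
  by (rule presented_ring.cohen_macaulay_ringI[OF stanley_reisner_ring_presented(1)],
      unfold stanley_reisner_ring_presented(2)) (fact assms)+

end

subsection \<open>Stanley-Reisner rings have no long chains of primes\<close>

text \<open>Each exponent is bounded separately, so the admissible exponents on a face form a box
  that is easy to count.\<close>

definition exponents_le :: "nat \<Rightarrow> ('v, 'k::field) mpoly \<Rightarrow> bool" where
  "exponents_le n p \<longleftrightarrow> (\<forall>m\<in>keys p. \<forall>v. lookup m v \<le> n)"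

lemma exponents_le_mono: "exponents_le m p \<Longrightarrow> m \<le> n \<Longrightarrow> exponents_le n p"
  unfolding exponents_le_def by (meson order_trans)

lemma exponents_le_one: "exponents_le n 1"
  by (simp add: exponents_le_def)

lemma exponents_le_mult:
  assumes "exponents_le a p" "exponents_le b q"
  shows "exponents_le (a + b) (p * q)"
  unfolding exponents_le_def
proof (intro ballI allI)
  fix m v assume "m \<in> keys (p * q)"
  then obtain m1 m2 where m: "m1 \<in> keys p" "m2 \<in> keys q" "m = m1 + m2"
    using keys_mult[of p q] by blast
  have "lookup m1 v \<le> a" "lookup m2 v \<le> b"
    using assms m by (auto simp: exponents_le_def)
  then show "lookup m v \<le> a + b"
    by (simp add: m lookup_add)
qed

lemma exponents_le_power: "exponents_le a p \<Longrightarrow> exponents_le (n * a) (p ^ n)"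
proof (induction n)
  case (Suc n)
  then show ?case
    using exponents_le_mult[of a p "n * a" "p ^ n"] by simp
qed (simp add: exponents_le_one)

lemma exponents_le_ex: "\<exists>n. exponents_le n p"
proof -
  have *: "lookup m v \<le> (\<Sum>v\<in>keys m. lookup m v)" for m :: "'a \<Rightarrow>\<^sub>0 nat" and v
    by (cases "v \<in> keys m") (auto intro: member_le_sum simp: not_in_keys_iff_lookup_eq_zero)
  have "lookup m v \<le> (\<Sum>m\<in>keys p. \<Sum>v\<in>keys m. lookup m v)" if m: "m \<in> keys p" for m v
  proof -
    have "(\<Sum>v\<in>keys m. lookup m v) \<le> (\<Sum>m\<in>keys p. \<Sum>v\<in>keys m. lookup m v)"
      using m by (intro member_le_sum) auto
    then show ?thesis
      using * le_trans by blast
  qed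
  then show ?thesis
    unfolding exponents_le_def by blast
qed

lemma exponents_le_monomial_value:
  assumes "\<And>x. x \<in> set xs \<Longrightarrow> exponents_le D x" "set e \<subseteq> {..N}"
  shows "exponents_le (length xs * (N * D)) (monomial_value xs e)"
  using assms
proof (induction xs e rule: monomial_value.induct)
  case (1 x xs n ns)
  have "exponents_le (n * D) (x ^ n)"
    using 1 by (intro exponents_le_power) auto
  then have "exponents_le (N * D) (x ^ n)"
    using 1 by (elim exponents_le_mono) auto
  moreover have "exponents_le (length xs * (N * D)) (monomial_value xs ns)"
    using 1 by auto
  ultimately have "exponents_le (N * D + length xs * (N * D)) (x ^ n * monomial_value xs ns)"
    by (rule exponents_le_mult)
  then show ?case
    by simp
qed (auto simp: exponents_le_one)

lemma lookup_const_mult: "lookup (single 0 c * p) m = c * lookup p m" for p :: "('v, 'k::field) mpoly"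
  by (simp add: map.rep_eq when_def flip: mult_map_scale_conv_mult)

lemma bounded_exponents_card:
  assumes "finite F"
  shows "finite {m. keys m \<subseteq> F \<and> (\<forall>v. lookup m v \<le> n)}" (is "finite ?M")
    and "card {m. keys m \<subseteq> F \<and> (\<forall>v. lookup m v \<le> n)} \<le> Suc n ^ card F"
proof -
  let ?f = "\<lambda>m. restrict (lookup m) F"
  have inj: "inj_on ?f ?M"
  proof (rule inj_onI, rule poly_mapping_eqI)
    fix m m' v
    assume m: "m \<in> ?M" "m' \<in> ?M" "?f m = ?f m'"
    show "lookup m v = lookup m' v"
    proof (cases "v \<in> F")
      case True
      then show ?thesis
        using fun_cong[OF m(3), of v] by simp
    next
      case False
      then have "v \<notin> keys m" "v \<notin> keys m'"
        using m by auto
      then show ?thesis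
        by (simp add: in_keys_iff)
    qed
  qed
  have sub: "?f ` ?M \<subseteq> F \<rightarrow>\<^sub>E {..n}"
    by auto
  have fin: "finite (F \<rightarrow>\<^sub>E {..n})"
    using assms by (intro finite_PiE) auto
  show "finite ?M"
    using finite_imageD[OF finite_subset[OF sub fin] inj] .
  have "card ?M = card (?f ` ?M)"
    by (rule card_image[OF inj, symmetric])
  also have "\<dots> \<le> card (F \<rightarrow>\<^sub>E {..n})"
    by (rule card_mono[OF fin sub])
  also have "\<dots> = Suc n ^ card F"
    using assms by (simp add: card_PiE)
  finally show "card ?M \<le> Suc n ^ card F" .
qed

context simplicial_complex
begin

lemma bounded_face_exponents_card:
  assumes "\<And>F. F \<in> \<Delta> \<Longrightarrow> card F \<le> d"
  shows "finite {m. keys m \<in> \<Delta> \<and> (\<forall>v. lookup m v \<le> n)}" (is "finite ?M")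
    and "card {m. keys m \<in> \<Delta> \<and> (\<forall>v. lookup m v \<le> n)} \<le> card \<Delta> * Suc n ^ d"
proof -
  let ?B = "\<lambda>F. {m. keys m \<subseteq> F \<and> (\<forall>v. lookup m v \<le> n)}"
  have sub: "?M \<subseteq> (\<Union>F\<in>\<Delta>. ?B F)"
    by auto
  have fin: "finite (\<Union>F\<in>\<Delta>. ?B F)"
    using finite_complex finite_face bounded_exponents_card(1) by blast
  show "finite ?M"
    by (rule finite_subset[OF sub fin])
  have "card ?M \<le> card (\<Union>F\<in>\<Delta>. ?B F)"
    by (rule card_mono[OF fin sub])
  also have "\<dots> \<le> (\<Sum>F\<in>\<Delta>. card (?B F))"
    by (rule card_UN_le[OF finite_complex])
  also have "\<dots> \<le> (\<Sum>F\<in>\<Delta>. Suc n ^ d)"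
  proof (rule sum_mono)
    fix F assume F: "F \<in> \<Delta>"
    have "card (?B F) \<le> Suc n ^ card F"
      by (rule bounded_exponents_card(2)[OF finite_face[OF F]])
    also have "\<dots> \<le> Suc n ^ d"
      using assms[OF F] by (intro power_increasing) auto
    finally show "card (?B F) \<le> Suc n ^ d" .
  qed
  finally show "card ?M \<le> card \<Delta> * Suc n ^ d"
    by simp
qed

text \<open>
  At most \<open>card \<Delta> * (n + 1) ^ d\<close> monomials with exponents bounded by \<open>n\<close> survive in the
  Stanley-Reisner ring, too few for \<open>d + 1\<close> elements to be algebraically independent.
\<close>

lemma no_long_prime_chain:
  fixes Q :: "nat \<Rightarrow> ('a, 'k::field) mpoly set"
  assumes dim: "\<And>F. F \<in> \<Delta> \<Longrightarrow> card F \<le> d"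
    and prime: "\<And>i. i \<le> Suc d \<Longrightarrow> is_prime (Q i)" and strict: "\<And>i. i \<le> d \<Longrightarrow> Q i \<subset> Q (Suc i)"
    and Q0: "nonface_ideal \<Delta> \<subseteq> Q 0"
  shows False
proof -
  have "\<forall>i. \<exists>x. i \<le> d \<longrightarrow> x \<in> Q (Suc i) - Q i"
    using strict by blast
  then obtain x where x: "\<And>i. i \<le> d \<Longrightarrow> x i \<in> Q (Suc i) - Q i"
    by metis
  have "\<forall>i. \<exists>n. exponents_le n (x i)"
    using exponents_le_ex by blast
  then obtain b where b: "\<And>i. exponents_le (b i) (x i)"
    by metis
  define D where "D = (\<Sum>i\<le>d. b i)"
  have D: "exponents_le D (x i)" if "i \<le> d" for i
    using that unfolding D_def by (intro exponents_le_mono[OF b] member_le_sum) auto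
  define xs where "xs = map x [0..<Suc d]"
  have xs: "length xs = Suc d" "\<And>i. i \<le> d \<Longrightarrow> xs ! i = x i" "\<And>y. y \<in> set xs \<Longrightarrow> exponents_le D y"
    using D by (auto simp: xs_def less_Suc_eq_le simp del: upt_Suc)
  \<comment> \<open>\<open>C\<close> is chosen for \<open>Suc n <= C * Suc N\<close>, and
    \<open>N\<close> absorbs \<open>card \<Delta> * C ^ d\<close>. At most
    \<open>N * Suc N ^ d\<close> equations then meet \<open>Suc N ^ Suc d\<close> unknowns.\<close>
  define C where "C = Suc d * D + 1"
  define N where "N = card \<Delta> * C ^ d"
  define n where "n = Suc d * (N * D)"
  define M where "M = {m :: 'a \<Rightarrow>\<^sub>0 nat. keys m \<in> \<Delta> \<and> (\<forall>v. lookup m v \<le> n)}"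
  define T where "T = {e. set e \<subseteq> {..N} \<and> length e = Suc d}"
  have T: "finite T" "card T = Suc N ^ Suc d"
    using finite_lists_length_eq[of "{..N}" "Suc d"] card_lists_length_eq[of "{..N}" "Suc d"]
    by (simp_all add: T_def)
  have "card M \<le> card \<Delta> * Suc n ^ d"
    unfolding M_def by (rule bounded_face_exponents_card(2)[OF dim])
  also have "\<dots> \<le> card \<Delta> * (C * Suc N) ^ d"
    by (intro mult_left_mono power_mono) (auto simp: n_def C_def algebra_simps)
  also have "\<dots> = N * Suc N ^ d"
    by (simp only: N_def power_mult_distrib mult.assoc)
  also have "\<dots> < card T"
    by (simp add: T(2))
  finally have card: "card M < card T" .
  have M: "finite M"
    unfolding M_def by (rule bounded_face_exponents_card(1)[OF dim])
  obtain c :: "nat list \<Rightarrow> 'k" where c: "\<exists>e\<in>T. c e \<noteq> 0"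
    and sol: "\<And>m. m \<in> M \<Longrightarrow> (\<Sum>e\<in>T. c e * lookup (monomial_value xs e) m) = 0"
    by (rule homogeneous_system_solvable[OF M T(1) card,
          of "\<lambda>m e. lookup (monomial_value xs e) m"]) blast
  \<comment> \<open>The remaining coefficients are units and lie in no prime.\<close>
  define T' where "T' = {e \<in> T. c e \<noteq> 0}"
  define p where "p = (\<Sum>e\<in>T'. single 0 (c e) * monomial_value xs e)"
  have lookup_p: "lookup p m = (\<Sum>e\<in>T. c e * lookup (monomial_value xs e) m)" for m
    unfolding p_def lookup_sum lookup_const_mult using T(1)
    by (intro sum.mono_neutral_left) (auto simp: T'_def)
  \<comment> \<open>The linear system cancels the face monomials with exponents up to
    \<open>n\<close>; larger exponents occur in none of the terms.\<close>
  have "p \<in> nonface_ideal \<Delta>"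
    unfolding nonface_ideal_def
  proof (intro CollectI ballI notI)
    fix m assume m: "m \<in> keys p" "keys m \<in> \<Delta>"
    have "\<exists>e\<in>T. lookup (monomial_value xs e) m \<noteq> 0"
    proof (rule ccontr)
      assume "\<not> ?thesis"
      then show False
        using m(1) by (simp add: in_keys_iff lookup_p)
    qed
    then obtain e where "e \<in> T" "m \<in> keys (monomial_value xs e)"
      by (auto simp: in_keys_iff)
    then have "\<forall>v. lookup m v \<le> n"
      using exponents_le_monomial_value[of xs D e N] xs(3) by (auto simp: exponents_le_def T_def n_def xs(1))
    then show False
      using sol[of m] m by (simp add: M_def in_keys_iff lookup_p)
  qed
  moreover have "p \<notin> Q 0"
    unfolding p_def
  proof (rule prime_chain_witnesses_independent)
    fix e assume e: "e \<in> T'"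
    show "single 0 (c e) \<notin> Q (length xs)"
    proof
      assume "single 0 (c e) \<in> Q (length xs)"
      then have "single 0 (inverse (c e)) * single 0 (c e) \<in> Q (length xs)"
        using prime by (intro ideal_mult prime_ideal) (auto simp: xs(1))
      then show False
        using e prime_one[OF prime] by (simp add: mult_single T'_def xs(1))
    qed
    show "length e = length xs"
      using e by (simp add: T'_def T_def xs(1))
  next
    show "T' \<noteq> {}"
      using c by (auto simp: T'_def)
  next
    fix i assume "i < length xs"
    then have "i \<le> d"
      by (simp add: xs(1))
    then show "Q i \<subseteq> Q (Suc i)" "xs ! i \<in> Q (Suc i) - Q i"
      using strict[of i] x[of i] xs(2)[of i] by auto
  qed (use T(1) prime in \<open>auto simp: T'_def xs(1)\<close>)
  ultimately show False
    using Q0 by blast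
qed

end

section \<open>Coordinates on an edge\<close>

definition ceval :: "('v, 'k) mpoly \<Rightarrow> 'k::field poly \<Rightarrow> ('v, 'k) mpoly" where
  "ceval a p = poly (map_poly (single 0) p) a"

lemma ceval_morphism: "ring_morphism (ceval a)"
  unfolding ceval_def by (rule ring_morphism.peval_morphism[OF const_morphism])

lemma ceval_const: "ceval a [:c:] = single 0 c"
  unfolding ceval_def by (rule ring_morphism.peval_const[OF const_morphism])

lemma ceval_X: "ceval a [:0, 1:] = a"
  unfolding ceval_def by (rule ring_morphism.peval_X[OF const_morphism])

text \<open>The inner variable \<open>X\<close> goes to \<open>a\<close> and the outer
  \<open>Y\<close> to \<open>b\<close>, which keeps the distinguished parameter \<open>a\<close>
  among the coefficients.\<close>

definition bieval :: "('v, 'k) mpoly \<Rightarrow> ('v, 'k) mpoly \<Rightarrow> 'k::field poly poly \<Rightarrow> ('v, 'k) mpoly" where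
  "bieval a b q = poly (map_poly (ceval a) q) b"

lemma bieval_morphism: "ring_morphism (bieval a b)"
  unfolding bieval_def by (intro ring_morphism.peval_morphism ceval_morphism)

lemma bieval_univariate: "bieval a b [:p:] = ceval a p"
  unfolding bieval_def by (rule ring_morphism.peval_const[OF ceval_morphism])

lemma bieval_const: "bieval a b [:[:c:]:] = single 0 c"
  by (simp add: bieval_univariate ceval_const)

lemma bieval_X: "bieval a b [:[:0, 1:]:] = a"
  by (simp add: bieval_univariate ceval_X)

lemma bieval_Y: "bieval a b [:0, 1:] = b"
  unfolding bieval_def by (rule ring_morphism.peval_X[OF ceval_morphism])

text \<open>The elements congruent to a value of \<open>f\<close> form a subring, so testing the
  generators is enough.\<close>

lemma surj_modulo_induct:
  fixes f :: "'a::comm_ring_1 \<Rightarrow> ('v, 'k::field) mpoly"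
  assumes f: "ring_morphism f" and P: "is_ideal P"
    and const: "\<And>c. \<exists>q. single 0 c - f q \<in> P" and var: "\<And>v. \<exists>q. mpoly_var v - f q \<in> P"
  shows "\<exists>q. p - f q \<in> P"
proof (induction p rule: mpoly_induct)
  interpret ring_morphism f by fact
  fix p1 p2
  assume "\<exists>q. p1 - f q \<in> P" "\<exists>q. p2 - f q \<in> P"
  then obtain q1 q2 where q: "p1 - f q1 \<in> P" "p2 - f q2 \<in> P"
    by blast
  have "p1 + p2 - f (q1 + q2) = (p1 - f q1) + (p2 - f q2)"
    by (simp add: hom_add)
  then show "\<exists>q. p1 + p2 - f q \<in> P"
    using ideal_add[OF P q] by metis
  have "p1 * p2 - f (q1 * q2) = p1 * (p2 - f q2) + f q2 * (p1 - f q1)"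
    by (simp add: hom_mult algebra_simps)
  then show "\<exists>q. p1 * p2 - f q \<in> P"
    using ideal_add[OF P ideal_mult[OF P q(2)] ideal_mult[OF P q(1)]] by metis
qed (use const var in auto)

lemma card_le_2_subset:
  assumes "finite F" "card F \<le> 2"
  obtains u w where "F \<subseteq> {u, w}"
proof -
  consider "card F = 0" | "card F = 1" | "card F = 2"
    using assms(2) by linarith
  then show thesis
  proof cases
    case 1
    then show thesis
      using assms(1) that by auto
  next
    case 2
    then obtain u where "F = {u}"
      by (auto simp: card_1_singleton_iff)
    then show thesis
      using that[of u u] by simp
  next
    case 3
    then obtain u w where "F = {u, w}"
      by (auto simp: card_2_iff)
    then show thesis
      using that[of u w] by simp
  qed
qed

text \<open>Modulo \<open>kernel_ideal F\<close> at most two variables are left, so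
  \<open>K[X][Y]\<close> maps onto the quotient and Hilbert's theorem applies twice. The finitely
  many faces are combined by intersection.\<close>

lemma (in simplicial_complex) nonface_ideal_noetherian:
  fixes J :: "('a, 'k::field) mpoly set"
  assumes dim: "\<And>F. F \<in> \<Delta> \<Longrightarrow> card F \<le> 2" and J: "is_ideal J" "nonface_ideal \<Delta> \<subseteq> J"
  shows "\<exists>B. finite B \<and> J = ideal_hull (B \<union> nonface_ideal \<Delta>)"
proof -
  have "finitely_generated_modulo (kernel_ideal F :: ('a, 'k) mpoly set)" if F: "F \<in> \<Delta>" for F
  proof -
    obtain u w where uw: "F \<subseteq> {u, w}"
      using card_le_2_subset[OF finite_face[OF F] dim[OF F]] by blast
    define f where "f = (bieval (mpoly_var u) (mpoly_var w) :: 'k poly poly \<Rightarrow> ('a, 'k) mpoly)"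
    have f: "ring_morphism f"
      unfolding f_def by (rule bieval_morphism)
    have zero: "0 \<in> (kernel_ideal F :: ('a, 'k) mpoly set)"
      by (rule ideal_zero[OF kernel_ideal_ideal])
    have "\<exists>q. p - f q \<in> kernel_ideal F" for p
    proof (rule surj_modulo_induct[OF f kernel_ideal_ideal])
      show "\<exists>q. single 0 c - f q \<in> kernel_ideal F" for c
        using zero by (intro exI[of _ "[:[:c:]:]"]) (simp add: f_def bieval_const)
      fix v
      show "\<exists>q. mpoly_var v - f q \<in> kernel_ideal F"
      proof (cases "v \<in> F")
        case True
        then have "f [:[:0, 1:]:] = mpoly_var v \<or> f [:0, 1:] = mpoly_var v"
          using uw by (auto simp: f_def bieval_X bieval_Y)
        then show ?thesis
          using zero by (metis diff_self)
      next
        case False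
        then show ?thesis
          using ring_morphism.hom_zero[OF f]
          by (intro exI[of _ 0]) (simp add: kernel_ideal_def restrict_vars_var)
      qed
    qed
    then show ?thesis
      by (intro finitely_generated_modulo_image[OF f kernel_ideal_ideal]
          hilbert_basis finitely_generated_ideals_field)
  qed
  then have "finitely_generated_modulo (nonface_ideal \<Delta> :: ('a, 'k) mpoly set)"
    unfolding nonface_ideal_eq
    by (intro finitely_generated_modulo_INT finite_complex kernel_ideal_ideal)
  then obtain B where "finite B" "B \<subseteq> J" "J \<subseteq> ideal_hull (B \<union> nonface_ideal \<Delta>)"
    by (rule finitely_generated_moduloE[OF _ J(1)])
  then show ?thesis
    using J ideal_hull_least[OF J(1), of "B \<union> nonface_ideal \<Delta>"] by (intro exI[of _ B]) blast
qed

section \<open>Vertex and edge coordinates, and regularity on a single face\<close>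

lemma ceval_hom:
  assumes "ring_morphism h" "\<And>c. h (single 0 c) = single 0 c"
  shows "h (ceval a p) = ceval (h a) p"
proof (rule poly_morphism_eqI[of "\<lambda>p. h (ceval a p)"])
  show "ring_morphism (\<lambda>p. h (ceval a p))"
    by (rule ring_morphism_comp[OF ceval_morphism assms(1)])
qed (auto simp: ceval_morphism ceval_const ceval_X assms)

lemma restrict_vars_ceval: "restrict_vars F (ceval a p) = ceval (restrict_vars F a) p"
  by (rule ceval_hom[OF restrict_vars_morphism restrict_vars_const])

lemma restrict_vars_congruent:
  assumes P: "is_ideal P" and var: "\<And>v. v \<notin> F \<Longrightarrow> mpoly_var v \<in> P"
  shows "p - restrict_vars F p \<in> P"
proof (induction p rule: mpoly_induct)
  interpret ring_morphism "restrict_vars F"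
    by (rule restrict_vars_morphism)
  fix p q
  assume pq: "p - restrict_vars F p \<in> P" "q - restrict_vars F q \<in> P"
  show "p + q - restrict_vars F (p + q) \<in> P"
    using ideal_add[OF P pq] by (simp add: hom_add algebra_simps)
  have "p * (q - restrict_vars F q) + restrict_vars F q * (p - restrict_vars F p) \<in> P"
    by (intro ideal_add[OF P] ideal_mult[OF P] pq)
  then show "p * q - restrict_vars F (p * q) \<in> P"
    by (simp add: hom_mult algebra_simps)
next
  show "mpoly_var v - restrict_vars F (mpoly_var v) \<in> P" for v
    using var ideal_zero[OF P] by (simp add: restrict_vars_var)
qed (simp add: restrict_vars_const ideal_zero[OF P])

text \<open>Identifies the polynomial ring of the vertex \<open>u\<close> with \<open>K[X]\<close>,
  a domain; the inverse is \<open>ceval (mpoly_var u)\<close>.\<close>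

definition vertex_coord :: "'v \<Rightarrow> ('v, 'k::field) mpoly \<Rightarrow> 'k poly" where
  "vertex_coord u = meval (\<lambda>c. [:c:]) (\<lambda>v. if v = u then [:0, 1:] else 0)"

text \<open>
  With \<open>x\<^sub>u \<mapsto> Y\<close> and \<open>x\<^sub>w \<mapsto> X - Y\<close> the sum \<open>x\<^sub>u + x\<^sub>w\<close> becomes the constant \<open>X\<close> of
  \<open>K[X][Y]\<close>.
\<close>

definition edge_coord :: "'v \<Rightarrow> 'v \<Rightarrow> ('v, 'k::field) mpoly \<Rightarrow> 'k poly poly" where
  "edge_coord u w = meval (\<lambda>c. [:[:c:]:])
     (\<lambda>v. if v = u then [:0, 1:] else if v = w then [:[:0, 1:], - 1:] else 0)"

lemma const_poly_morphism: "ring_morphism (\<lambda>c::'a::comm_ring_1. [:c:])"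
  by standard (auto simp: one_pCons)

lemma const_poly_poly_morphism: "ring_morphism (\<lambda>c::'a::comm_ring_1. [:[:c:]:])"
  by (rule ring_morphism_comp[OF const_poly_morphism const_poly_morphism])

lemma vertex_coord_morphism: "ring_morphism (vertex_coord u)"
  unfolding vertex_coord_def by (rule meval_morphism[OF const_poly_morphism])

lemma edge_coord_morphism: "ring_morphism (edge_coord u w)"
  unfolding edge_coord_def by (rule meval_morphism[OF const_poly_poly_morphism])

lemma vertex_coord_const: "vertex_coord u (single 0 c) = [:c:]"
  unfolding vertex_coord_def by (rule meval_const[OF const_poly_morphism])

lemma edge_coord_const: "edge_coord u w (single 0 c) = [:[:c:]:]"
  unfolding edge_coord_def by (rule meval_const[OF const_poly_poly_morphism])

lemma vertex_coord_var: "vertex_coord u (mpoly_var v) = (if v = u then [:0, 1:] else 0)"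
  unfolding vertex_coord_def by (rule meval_var[OF const_poly_morphism])

lemma edge_coord_var:
  "edge_coord u w (mpoly_var v) = (if v = u then [:0, 1:] else if v = w then [:[:0, 1:], - 1:] else 0)"
  unfolding edge_coord_def by (rule meval_var[OF const_poly_poly_morphism])

lemma ceval_vertex_coord: "ceval (mpoly_var u) (vertex_coord u p) = restrict_vars {u} p"
proof (rule mpoly_morphism_eqI[of "\<lambda>p. ceval (mpoly_var u) (vertex_coord u p)"])
  show "ring_morphism (\<lambda>p. ceval (mpoly_var u) (vertex_coord u p))"
    by (rule ring_morphism_comp[OF vertex_coord_morphism ceval_morphism])
qed (auto simp: restrict_vars_morphism vertex_coord_const vertex_coord_var ceval_const ceval_X
    restrict_vars_const restrict_vars_var ring_morphism.hom_zero[OF ceval_morphism])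

lemma vertex_coord_ceval: "vertex_coord u (ceval (mpoly_var u) f) = f"
proof (rule poly_morphism_eqI[of "\<lambda>f. vertex_coord u (ceval (mpoly_var u) f)" "\<lambda>f. f"])
  show "ring_morphism (\<lambda>f. vertex_coord u (ceval (mpoly_var u) f))"
    by (rule ring_morphism_comp[OF ceval_morphism vertex_coord_morphism])
  show "ring_morphism (\<lambda>f::'a poly. f)"
    by standard auto
qed (auto simp: vertex_coord_const vertex_coord_var ceval_const ceval_X)

lemma bieval_edge_coord:
  assumes "u \<noteq> w"
  shows "bieval (mpoly_var u + mpoly_var w) (mpoly_var u) (edge_coord u w p) = restrict_vars {u, w} p"
proof (rule mpoly_morphism_eqI[of "\<lambda>p. bieval (mpoly_var u + mpoly_var w) (mpoly_var u) (edge_coord u w p)"])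
  let ?b = "bieval (mpoly_var u + mpoly_var w) (mpoly_var u)"
  interpret ring_morphism ?b
    by (rule bieval_morphism)
  show "ring_morphism (\<lambda>p. ?b (edge_coord u w p))"
    by (rule ring_morphism_comp[OF edge_coord_morphism bieval_morphism])
  have "?b [:[:0, 1:], - 1:] = ?b ([:[:0, 1:]:] - [:0, 1:])"
    by simp
  also have "\<dots> = mpoly_var w"
    by (simp only: hom_diff bieval_X bieval_Y) simp
  finally show "?b (edge_coord u w (mpoly_var v)) = restrict_vars {u, w} (mpoly_var v)" for v
    by (auto simp: edge_coord_var restrict_vars_var bieval_Y hom_zero)
qed (auto simp: restrict_vars_morphism edge_coord_const bieval_const restrict_vars_const)

lemma edge_coord_ceval:
  assumes "u \<noteq> w"
  shows "edge_coord u w (ceval (mpoly_var u + mpoly_var w) f) = [:f:]"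
proof (rule poly_morphism_eqI[of "\<lambda>f. edge_coord u w (ceval (mpoly_var u + mpoly_var w) f)"])
  show "ring_morphism (\<lambda>f. edge_coord u w (ceval (mpoly_var u + mpoly_var w) f))"
    by (rule ring_morphism_comp[OF ceval_morphism edge_coord_morphism])
qed (use assms in \<open>auto simp: const_poly_morphism edge_coord_const edge_coord_var ceval_const ceval_X
    ring_morphism.hom_add[OF edge_coord_morphism]\<close>)

text \<open>The variable becomes \<open>Y\<close> or \<open>X - Y\<close>, with leading coefficient
  1 or -1 in \<open>Y\<close>. Substitution into \<open>g\<close> multiplies
  \<open>lead_coeff g\<close> by a power of that sign.\<close>

lemma edge_coord_ceval_var:
  fixes g :: "'k::field poly"
  assumes "v = u \<or> v = w" "g \<noteq> 0"
  shows "lead_coeff (edge_coord u w (ceval (mpoly_var v) g)) dvd 1"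
proof -
  define y :: "'k poly poly" where "y = edge_coord u w (mpoly_var v)"
  define g' where "g' = map_poly (\<lambda>c. [:c:]) g"
  have "edge_coord u w (ceval (mpoly_var v) g) = pcompose g' y"
    unfolding g'_def
  proof (rule poly_morphism_eqI[of "\<lambda>g. edge_coord u w (ceval (mpoly_var v) g)"
        "\<lambda>g. pcompose (map_poly (\<lambda>c. [:c:]) g) y"])
    show "ring_morphism (\<lambda>f. edge_coord u w (ceval (mpoly_var v) f))"
      by (rule ring_morphism_comp[OF ceval_morphism edge_coord_morphism])
    have "pcompose (map_poly (\<lambda>c. [:c:]) g) y = poly (map_poly (\<lambda>c. [:[:c:]:]) g) y" for g :: "'k poly"
      by (simp add: pcompose_altdef map_poly_map_poly o_def)
    then show "ring_morphism (\<lambda>g. pcompose (map_poly (\<lambda>c. [:c:]) g) y)"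
      using ring_morphism.peval_morphism[OF const_poly_poly_morphism] by simp
    have "map_poly (\<lambda>c::'k. [:c:]) [:0, 1:] = [:0, 1:]"
      by (simp add: map_poly_pCons one_pCons)
    then show "edge_coord u w (ceval (mpoly_var v) [:0, 1:]) = pcompose (map_poly (\<lambda>c. [:c:]) [:0, 1:]) y"
      by (simp only: ceval_X y_def) (simp add: pcompose_pCons)
  qed (simp add: edge_coord_const ceval_const map_poly_pCons pcompose_pCons)
  moreover have "lead_coeff (pcompose g' y) = lead_coeff g' * lead_coeff y ^ degree g'"
    using assms(1) by (intro lead_coeff_comp) (auto simp: y_def edge_coord_var)
  moreover have "lead_coeff g' = [:lead_coeff g:]"
    by (simp add: g'_def degree_map_poly coeff_map_poly)
  moreover have "lead_coeff y dvd 1"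
    using assms(1) by (auto simp: y_def edge_coord_var)
  then have "lead_coeff y ^ n dvd 1" for n
    by (induction n) (auto intro: mult_dvd_mono[where b = 1 and d = 1, simplified])
  moreover have "[:lead_coeff g:] dvd 1"
    using assms(2) by (simp add: is_unit_const_poly_iff dvd_field_iff)
  ultimately show ?thesis
    using mult_dvd_mono[of "[:lead_coeff g:]" 1 "lead_coeff y ^ degree g'" 1] by simp
qed

lemma vertex_nonzerodivisor:
  assumes "f \<noteq> 0" "restrict_vars {u} a = mpoly_var u" "restrict_vars {u} (ceval a f * p) = 0"
  shows "restrict_vars {u} p = 0"
proof -
  have "ceval (mpoly_var u) f * restrict_vars {u} p = 0"
    using assms by (simp add: ring_morphism.hom_mult[OF restrict_vars_morphism] restrict_vars_ceval)
  then have "vertex_coord u (ceval (mpoly_var u) f * restrict_vars {u} p) = 0"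
    by (simp add: ring_morphism.hom_zero[OF vertex_coord_morphism])
  then have "f * vertex_coord u (restrict_vars {u} p) = 0"
    by (simp add: ring_morphism.hom_mult[OF vertex_coord_morphism] vertex_coord_ceval)
  then have "vertex_coord u (restrict_vars {u} p) = 0"
    using assms(1) by simp
  then have "restrict_vars {u} (restrict_vars {u} p) = 0"
    using ceval_vertex_coord[of u "restrict_vars {u} p"] ring_morphism.hom_zero[OF ceval_morphism] by metis
  then show ?thesis
    by (simp add: restrict_vars_restrict_vars)
qed

lemma edge_regular:
  assumes uw: "u \<noteq> w" and a: "restrict_vars {u, w} a = mpoly_var u + mpoly_var w"
    and G: "restrict_vars {u, w} G = ceval (mpoly_var u) g * ceval (mpoly_var w) g" and g: "g \<noteq> 0"
    and eq: "restrict_vars {u, w} (G * p - q * ceval a f) = 0"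
  shows "\<exists>c. restrict_vars {u, w} (p - c * ceval a f) = 0"
proof -
  interpret \<rho>: ring_morphism "restrict_vars {u, w}"
    by (rule restrict_vars_morphism)
  interpret \<psi>: ring_morphism "edge_coord u w"
    by (rule edge_coord_morphism)
  let ?b = "bieval (mpoly_var u + mpoly_var w) (mpoly_var u)"
  interpret b: ring_morphism ?b
    by (rule bieval_morphism)
  define G' where "G' = edge_coord u w (restrict_vars {u, w} G)"
  define p' where "p' = edge_coord u w (restrict_vars {u, w} p)"
  have "lead_coeff G' dvd 1"
    using mult_dvd_mono[OF edge_coord_ceval_var[of u u w g] edge_coord_ceval_var[of w u w g]] g
    by (simp add: G'_def G \<psi>.hom_mult lead_coeff_mult)
  moreover have "[:f:] dvd G' * p'"
  proof -
    have "restrict_vars {u, w} G * restrict_vars {u, w} p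
        = restrict_vars {u, w} q * ceval (mpoly_var u + mpoly_var w) f"
      using eq by (simp add: \<rho>.hom_diff \<rho>.hom_mult restrict_vars_ceval a)
    then have "G' * p' = edge_coord u w (restrict_vars {u, w} q) * [:f:]"
      by (metis G'_def p'_def \<psi>.hom_mult edge_coord_ceval[OF uw])
    then show ?thesis
      by (metis dvd_triv_right)
  qed
  ultimately have "[:f:] dvd p'"
    by (rule const_dvd_mult_cancel)
  then obtain e where e: "p' = [:f:] * e"
    by (rule dvdE)
  have "restrict_vars {u, w} p = ?b p'"
    by (simp add: p'_def bieval_edge_coord[OF uw] restrict_vars_restrict_vars)
  also have "\<dots> = ceval (mpoly_var u + mpoly_var w) f * ?b e"
    by (simp only: e b.hom_mult bieval_univariate)
  finally have p: "restrict_vars {u, w} p = ceval (mpoly_var u + mpoly_var w) f * ?b e" .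
  \<comment> \<open>The multiplier \<open>?b e\<close> appears restricted in the goal, so the
    equation is restricted once more; its other factor is unchanged by that.\<close>
  have "restrict_vars {u, w} (restrict_vars {u, w} p) = ceval (mpoly_var u + mpoly_var w) f * restrict_vars {u, w} (?b e)"
    unfolding p by (simp add: \<rho>.hom_mult restrict_vars_ceval \<rho>.hom_add restrict_vars_var)
  then have "restrict_vars {u, w} (p - ?b e * ceval a f) = 0"
    by (simp add: restrict_vars_restrict_vars \<rho>.hom_diff \<rho>.hom_mult restrict_vars_ceval a mult.commute)
  then show ?thesis
    by blast
qed

lemma edge_nonzerodivisor:
  assumes uw: "u \<noteq> w" and f: "f \<noteq> 0" and a: "restrict_vars {u, w} a = mpoly_var u + mpoly_var w"
    and eq: "restrict_vars {u, w} (ceval a f * p) = 0"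
  shows "restrict_vars {u, w} p = 0"
proof -
  have "ceval (mpoly_var u + mpoly_var w) f * restrict_vars {u, w} p = 0"
    using assms by (simp add: ring_morphism.hom_mult[OF restrict_vars_morphism] restrict_vars_ceval)
  then have "edge_coord u w (ceval (mpoly_var u + mpoly_var w) f * restrict_vars {u, w} p) = 0"
    by (simp add: ring_morphism.hom_zero[OF edge_coord_morphism])
  then have "[:f:] * edge_coord u w (restrict_vars {u, w} p) = 0"
    by (simp add: ring_morphism.hom_mult[OF edge_coord_morphism] edge_coord_ceval[OF uw])
  then have "edge_coord u w (restrict_vars {u, w} p) = 0"
    using f by simp
  then have "restrict_vars {u, w} (restrict_vars {u, w} p) = 0"
    using bieval_edge_coord[OF uw, of "restrict_vars {u, w} p"] ring_morphism.hom_zero[OF bieval_morphism] by metis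
  then show ?thesis
    by (simp add: restrict_vars_restrict_vars)
qed

text \<open>\<open>gen\<close> makes \<open>bieval a b\<close> onto modulo \<open>M\<close>, so
  \<open>M\<close> contracts to a maximal ideal of \<open>K[X][Y]\<close>. The nonzero polynomial in
  \<open>X\<close> found there is evaluated at \<open>a\<close>.\<close>

lemma algebraic_modulo_maximal:
  assumes M: "is_maximal M" and gen: "\<And>v. \<exists>q. mpoly_var v - bieval a b q \<in> M"
  obtains f where "f \<noteq> 0" "ceval a f \<in> M"
proof -
  interpret ring_morphism "bieval a b"
    by (rule bieval_morphism)
  have Mi: "is_ideal M" and one: "1 \<notin> M" and inv: "\<And>x. x \<notin> M \<Longrightarrow> \<exists>y. x * y - 1 \<in> M"
    using M by (auto simp: is_maximal_def)
  have "is_maximal (bieval a b -` M)"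
    unfolding is_maximal_def
  proof (intro conjI allI impI)
    show "is_ideal (bieval a b -` M)"
      by (rule hom_vimage_ideal[OF Mi])
    show "1 \<notin> bieval a b -` M"
      using one by (simp add: hom_one)
    fix x assume "x \<notin> bieval a b -` M"
    then obtain y where y: "bieval a b x * y - 1 \<in> M"
      using inv by auto
    have "\<exists>q. y - bieval a b q \<in> M"
    proof (rule surj_modulo_induct[OF bieval_morphism Mi])
      show "\<exists>q. single 0 c - bieval a b q \<in> M" for c
        using ideal_zero[OF Mi] bieval_const by (metis diff_self)
    qed (rule gen)
    then obtain q where q: "y - bieval a b q \<in> M" ..
    have "(bieval a b x * y - 1) - bieval a b x * (y - bieval a b q) \<in> M"
      by (intro ideal_diff[OF Mi] ideal_mult[OF Mi] y q)
    then have "bieval a b (x * q - 1) \<in> M"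
      by (simp add: hom_diff hom_mult hom_one algebra_simps)
    then show "\<exists>y. x * y - 1 \<in> bieval a b -` M"
      by blast
  qed
  then show thesis
    by (rule maximal_ideal_meets_univariate) (use that in \<open>auto simp: bieval_univariate\<close>)
qed

section \<open>Regular sequences in Stanley-Reisner rings\<close>

lemma prime_prod_mem:
  assumes "is_prime Q" "finite A" "prod f A \<in> Q"
  shows "\<exists>x\<in>A. f x \<in> Q"
  using assms(2,3)
  by (induction A) (use prime_one[OF assms(1)] prime_mult[OF assms(1)] in auto)

text \<open>\<open>d\<close> is the dimension plus one, so a nonempty complex of this kind is
  \<open>{{}}\<close>, a set of points or a connected graph. A singleton face counts as a walk step
  that stands still.\<close>

locale connected_low_dim_complex = simplicial_complex \<Delta> for \<Delta> :: "'a set set" +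
  fixes d :: nat
  assumes pure: "F \<in> \<Delta> \<Longrightarrow> \<exists>F'\<in>\<Delta>. F \<subseteq> F' \<and> card F' = d"
    and dim: "F \<in> \<Delta> \<Longrightarrow> card F \<le> d"
    and d_le: "d \<le> 2"
    and connected: "d = 2 \<Longrightarrow> u \<in> \<Union>\<Delta> \<Longrightarrow> v \<in> \<Union>\<Delta> \<Longrightarrow> (u, v) \<in> {(x, y). {x, y} \<in> \<Delta>}\<^sup>*"
begin

lemma nonface_ideal_iff:
  "p \<in> nonface_ideal \<Delta> \<longleftrightarrow> (\<forall>F\<in>\<Delta>. card F = d \<longrightarrow> restrict_vars F p = 0)" (is "_ \<longleftrightarrow> ?R")
proof
  assume R: ?R
  have "restrict_vars F p = 0" if F: "F \<in> \<Delta>" for F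
  proof -
    obtain F' where F': "F' \<in> \<Delta>" "F \<subseteq> F'" "card F' = d"
      using pure[OF F] by blast
    then have "restrict_vars F (restrict_vars F' p) = 0"
      using R ring_morphism.hom_zero[OF restrict_vars_morphism] by simp
    then show ?thesis
      using F'(2) by (simp add: restrict_vars_restrict_vars Int_absorb2)
  qed
  then show "p \<in> nonface_ideal \<Delta>"
    by (simp add: nonface_ideal_eq kernel_ideal_def)
qed (simp add: nonface_ideal_eq kernel_ideal_def)

definition vertex_sum :: "('a, 'k::field) mpoly" where
  "vertex_sum = (\<Sum>v\<in>\<Union>\<Delta>. mpoly_var v)"

lemma finite_vertices: "finite (\<Union>\<Delta>)"
  using finite_complex finite_face by blast

lemma restrict_vertex_sum:
  assumes "F \<in> \<Delta>"
  shows "restrict_vars F vertex_sum = (\<Sum>v\<in>F. mpoly_var v)"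
proof -
  have "restrict_vars F vertex_sum = (\<Sum>v\<in>\<Union>\<Delta>. if v \<in> F then mpoly_var v else 0)"
    by (simp add: vertex_sum_def ring_morphism.hom_sum[OF restrict_vars_morphism] restrict_vars_var)
  also have "\<dots> = (\<Sum>v\<in>\<Union>\<Delta> \<inter> F. mpoly_var v)"
    by (rule sum.inter_restrict[OF finite_vertices, symmetric])
  also have "\<Union>\<Delta> \<inter> F = F"
    using assms by blast
  finally show ?thesis .
qed

lemma vertex_face: "v \<in> \<Union>\<Delta> \<Longrightarrow> {v} \<in> \<Delta>"
  using subface by blast

text \<open>\<open>M\<close> contains the product of the variables of any finite nonface and is
  prime, so some factor lies in \<open>M\<close>. Nonvertex variables lie in \<open>M\<close> as
  well, which makes the set finite.\<close>

lemma nonzero_variables_face: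
  assumes M: "is_maximal M" "nonface_ideal \<Delta> \<subseteq> M"
  shows "{v. mpoly_var v \<notin> M} \<in> \<Delta>"
proof -
  let ?F = "{v. mpoly_var v \<notin> M}"
  have nonface: "single (squarefree_exponent F) 1 \<in> M" if "finite F" "F \<notin> \<Delta>" for F
    using that M(2) by (auto simp: nonface_ideal_def keys_squarefree_exponent)
  have "?F \<subseteq> \<Union>\<Delta>"
  proof
    fix v assume "v \<in> ?F"
    moreover have "mpoly_var v = single (squarefree_exponent {v}) 1"
      by (simp add: mpoly_var_def squarefree_exponent_def)
    ultimately show "v \<in> \<Union>\<Delta>"
      using nonface[of "{v}"] by (cases "{v} \<in> \<Delta>") auto
  qed
  then have fin: "finite ?F"
    using finite_vertices finite_subset by blast
  show ?thesis
  proof (rule ccontr)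
    assume "?F \<notin> \<Delta>"
    then have "(\<Prod>v\<in>?F. mpoly_var v) \<in> M"
      using nonface[OF fin] by (simp add: prod_mpoly_var)
    then show False
      using prime_prod_mem[OF maximal_prime[OF M(1)] fin] by auto
  qed
qed

lemma vertex_sum_regular:
  assumes f: "f \<noteq> 0" and d: "d \<noteq> 0" and mem: "ceval vertex_sum f * p \<in> nonface_ideal \<Delta>"
  shows "p \<in> nonface_ideal \<Delta>"
  unfolding nonface_ideal_iff
proof (intro ballI impI)
  fix F assume F: "F \<in> \<Delta>" "card F = d"
  have zero: "restrict_vars F (ceval vertex_sum f * p) = 0"
    using mem F by (auto simp: nonface_ideal_iff)
  consider u where "F = {u}" | u w where "F = {u, w}" "u \<noteq> w"
    using F(2) d d_le by (metis One_nat_def card_1_singletonE card_2_iff le_antisym less_2_cases_iff not_less)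
  then show "restrict_vars F p = 0"
  proof cases
    case 1
    then show ?thesis
      using vertex_nonzerodivisor[OF f, of u vertex_sum p] restrict_vertex_sum[OF F(1)] zero by simp
  next
    case 2
    then show ?thesis
      using edge_nonzerodivisor[OF 2(2) f, of vertex_sum p] restrict_vertex_sum[OF F(1)] zero by simp
  qed
qed

lemma vertex_sum_congruent:
  assumes M: "is_ideal M" and F: "F \<in> \<Delta>" "\<And>v. v \<notin> F \<Longrightarrow> mpoly_var v \<in> M"
  shows "vertex_sum - (\<Sum>v\<in>F. mpoly_var v) \<in> M"
  using restrict_vars_congruent[of M F vertex_sum, OF M F(2)] by (simp add: restrict_vertex_sum[OF F(1)])

text \<open>Modulo \<open>M\<close> only the one or two variables of \<open>F\<close> survive. One
  is \<open>x_u\<close>, and a second is congruent to \<open>vertex_sum\<close> minus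
  \<open>x_u\<close>, so these two elements generate everything.\<close>

lemma vertex_sum_algebraic:
  fixes M :: "('a, 'k::field) mpoly set"
  assumes M: "is_maximal M" and F: "F \<in> \<Delta>" "card F = d" "d \<noteq> 0" "\<And>v. v \<notin> F \<Longrightarrow> mpoly_var v \<in> M"
  obtains f where "f \<noteq> 0" "ceval vertex_sum f \<in> M"
proof -
  have Mi: "is_ideal M"
    using M by (simp add: is_maximal_def)
  obtain u where u: "u \<in> F"
    using F(2,3) by fastforce
  have "\<exists>q. mpoly_var v - bieval vertex_sum (mpoly_var u) q \<in> M" for v
  proof -
    interpret ring_morphism "bieval vertex_sum (mpoly_var u)"
      by (rule bieval_morphism)
    consider "v \<notin> F" | "v = u" | "v \<in> F" "v \<noteq> u"
      by blast
    then show ?thesis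
    proof cases
      case 1
      then show ?thesis
        using F(4) by (intro exI[of _ 0]) (simp add: hom_zero)
    next
      case 2
      then show ?thesis
        using ideal_zero[OF Mi] by (intro exI[of _ "[:0, 1:]"]) (simp add: bieval_Y)
    next
      case 3
      have "{u, v} \<subseteq> F" "card {u, v} = 2" "finite F"
        using u 3 finite_face[OF F(1)] by auto
      then have "F = {u, v}"
        using d_le F(2) by (metis card_seteq)
      then have "vertex_sum - (mpoly_var u + mpoly_var v) \<in> M"
        using vertex_sum_congruent[OF Mi F(1,4)] 3 by simp
      moreover have "mpoly_var v - bieval vertex_sum (mpoly_var u) ([:[:0, 1:]:] - [:0, 1:])
          = - (vertex_sum - (mpoly_var u + mpoly_var v))"
        by (simp only: hom_diff bieval_X bieval_Y) simp
      ultimately show ?thesis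
        using ideal_uminus[OF Mi] by metis
    qed
  qed
  from algebraic_modulo_maximal[OF M this] show thesis
    using that .
qed

text \<open>Connectedness is what makes the constant terms agree.\<close>

lemma glue:
  fixes c :: "'a set \<Rightarrow> ('a, 'k::field) mpoly"
  assumes d: "d = 2"
    and agree: "\<And>F F' v. F \<in> \<Delta> \<Longrightarrow> F' \<in> \<Delta> \<Longrightarrow> card F = 2 \<Longrightarrow> card F' = 2 \<Longrightarrow> v \<in> F \<Longrightarrow> v \<in> F' \<Longrightarrow>
      restrict_vars {v} (c F) = restrict_vars {v} (c F')"
  shows "\<exists>p. \<forall>F\<in>\<Delta>. card F = 2 \<longrightarrow> restrict_vars F p = restrict_vars F (c F)"
proof -
  define \<F> where "\<F> = {F \<in> \<Delta>. card F = 2}"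
  have vertex: "lookup (c F) m = lookup (c F') m"
    if "F \<in> \<F>" "F' \<in> \<F>" "v \<in> F" "v \<in> F'" "keys m \<subseteq> {v}" for F F' m v
    using arg_cong[OF agree, of F F' v "\<lambda>p. lookup p m"] that by (simp add: \<F>_def lookup_restrict_vars)
  have const: "lookup (c F) 0 = lookup (c F') 0" if F: "F \<in> \<F>" "F' \<in> \<F>" for F F'
  proof -
    obtain u v where uv: "u \<in> F" "v \<in> F'"
      using F by (auto simp: \<F>_def card_2_iff)
    then have "(u, v) \<in> {(x, y). {x, y} \<in> \<Delta>}\<^sup>*"
      using F d by (intro connected) (auto simp: \<F>_def)
    \<comment> \<open>Invariant along the walk: all edges at the current vertex carry the constant
      term of \<open>F\<close>.\<close>
    then have "\<forall>F'\<in>\<F>. v \<in> F' \<longrightarrow> lookup (c F) 0 = lookup (c F') 0"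
    proof (induction rule: rtrancl_induct)
      case base
      then show ?case
        using vertex[OF F(1)] uv(1) by simp
    next
      case (step y z)
      show ?case
      proof (cases "y = z")
        case False
        then have yz: "{y, z} \<in> \<F>"
          using step.hyps(2) by (simp add: \<F>_def)
        show ?thesis
        proof (intro ballI impI)
          fix F' assume F': "F' \<in> \<F>" "z \<in> F'"
          have "lookup (c F) 0 = lookup (c {y, z}) 0"
            using step.IH yz by simp
          also have "\<dots> = lookup (c F') 0"
            using vertex[OF yz F'(1), of z 0] F'(2) by simp
          finally show "lookup (c F) 0 = lookup (c F') 0" .
        qed
      qed (use step.IH in simp)
    qed
    then show ?thesis
      using uv F by blast
  qed
  \<comment> \<open>Distinct edges share at most one vertex, so a common monomial is constant or a
    power of one variable.\<close>
  have well_defined: "lookup (c F) m = lookup (c F') m"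
    if F: "F \<in> \<F>" "F' \<in> \<F>" and m: "keys m \<subseteq> F" "keys m \<subseteq> F'" for F F' m
  proof (cases "F = F'")
    case False
    have card: "card F = 2" "card F' = 2" "finite F" "finite F'"
      using F finite_face by (auto simp: \<F>_def)
    have "\<not> F \<subseteq> F'"
      using False card by (metis card_subset_eq)
    then have "F \<inter> F' \<subset> F"
      by blast
    then have "card (F \<inter> F') < 2"
      using psubset_card_mono[OF card(3)] card(1) by metis
    moreover have "card (keys m) \<le> card (F \<inter> F')"
      using m card(3) by (intro card_mono) auto
    ultimately consider "card (keys m) = 0" | "card (keys m) = 1"
      by linarith
    then show ?thesis
    proof cases
      case 1
      then have "m = 0"
        by simp
      then show ?thesis
        using const[OF F] by simp
    next
      case 2
      then obtain v where "keys m = {v}"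
        by (auto simp: card_1_singleton_iff)
      then show ?thesis
        using vertex[OF F, of v m] m by simp
    qed
  qed simp
  \<comment> \<open>Any edge containing the support of a monomial may supply its coefficient; a
    monomial on no edge gets 0.\<close>
  define g where "g m = (if \<exists>F\<in>\<F>. keys m \<subseteq> F then lookup (c (SOME F. F \<in> \<F> \<and> keys m \<subseteq> F)) m else 0)" for m
  have g: "g m = lookup (c F) m" if "F \<in> \<F>" "keys m \<subseteq> F" for F m
  proof -
    have "(SOME F. F \<in> \<F> \<and> keys m \<subseteq> F) \<in> \<F> \<and> keys m \<subseteq> (SOME F. F \<in> \<F> \<and> keys m \<subseteq> F)"
      by (rule someI_ex) (use that in blast)
    then show ?thesis
      using well_defined that unfolding g_def by (metis (no_types, lifting))
  qed
  have "{m. g m \<noteq> 0} \<subseteq> (\<Union>F\<in>\<F>. keys (c F))"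
  proof
    fix m assume m: "m \<in> {m. g m \<noteq> 0}"
    then obtain F where "F \<in> \<F>" "keys m \<subseteq> F"
      by (auto simp: g_def split: if_splits)
    then show "m \<in> (\<Union>F\<in>\<F>. keys (c F))"
      using m g by (auto simp: in_keys_iff)
  qed
  moreover have "finite (\<Union>F\<in>\<F>. keys (c F))"
    using finite_complex by (auto simp: \<F>_def)
  ultimately have "finite {m. g m \<noteq> 0}"
    by (rule finite_subset)
  then have "lookup (Abs_poly_mapping g) = g"
    by (rule lookup_Abs_poly_mapping)
  then have "restrict_vars F (Abs_poly_mapping g) = restrict_vars F (c F)" if "F \<in> \<F>" for F
    using g[OF that] by (intro poly_mapping_eqI) (simp add: lookup_restrict_vars)
  then show ?thesis
    by (auto simp: \<F>_def)
qed

text \<open>At a vertex common to two edges, both quotients \<open>c F\<close> divide the same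
  restriction of \<open>p\<close> by the same nonzero polynomial in \<open>x_v\<close>. Cancelling
  it there gives the agreement that \<open>glue\<close> requires.\<close>

lemma regular_pair_second:
  assumes d: "d = 2" and f: "f \<noteq> 0" and g: "g \<noteq> 0"
    and G: "\<And>F. F \<in> \<Delta> \<Longrightarrow> card F = 2 \<Longrightarrow> restrict_vars F G = (\<Prod>v\<in>F. ceval (mpoly_var v) g)"
    and mem: "G * p - q * ceval vertex_sum f \<in> nonface_ideal \<Delta>"
  shows "\<exists>c. p - c * ceval vertex_sum f \<in> nonface_ideal \<Delta>"
proof -
  let ?\<theta> = "ceval vertex_sum f"
  have "\<exists>c. restrict_vars F (p - c * ?\<theta>) = 0" if F: "F \<in> \<Delta>" "card F = 2" for F
  proof -
    obtain u w where uw: "F = {u, w}" "u \<noteq> w"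
      using F(2) by (auto simp: card_2_iff)
    show ?thesis
      unfolding uw(1)
    proof (rule edge_regular[OF uw(2) _ _ g])
      show "restrict_vars {u, w} vertex_sum = mpoly_var u + mpoly_var w"
        using restrict_vertex_sum[OF F(1)] uw by simp
      show "restrict_vars {u, w} G = ceval (mpoly_var u) g * ceval (mpoly_var w) g"
        using G[OF F] uw by simp
      show "restrict_vars {u, w} (G * p - q * ?\<theta>) = 0"
        using mem F d uw(1) by (auto simp: nonface_ideal_iff)
    qed
  qed
  then obtain c where c: "\<And>F. F \<in> \<Delta> \<Longrightarrow> card F = 2 \<Longrightarrow> restrict_vars F (p - c F * ?\<theta>) = 0"
    by metis
  have c_vertex: "restrict_vars {v} (p - c F * ?\<theta>) = 0" if "F \<in> \<Delta>" "card F = 2" "v \<in> F" for F v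
  proof -
    have "restrict_vars {v} (restrict_vars F (p - c F * ?\<theta>)) = 0"
      using c[OF that(1,2)] ring_morphism.hom_zero[OF restrict_vars_morphism] by simp
    then show ?thesis
      using that(3) by (simp add: restrict_vars_restrict_vars Int_absorb2)
  qed
  have agree: "restrict_vars {v} (c F) = restrict_vars {v} (c F')"
    if F: "F \<in> \<Delta>" "F' \<in> \<Delta>" "card F = 2" "card F' = 2" "v \<in> F" "v \<in> F'" for F F' v
  proof -
    interpret \<rho>: ring_morphism "restrict_vars {v}"
      by (rule restrict_vars_morphism)
    have "?\<theta> * (c F - c F') = (p - c F' * ?\<theta>) - (p - c F * ?\<theta>)"
      by (simp add: algebra_simps)
    then have "restrict_vars {v} (?\<theta> * (c F - c F'))
        = restrict_vars {v} (p - c F' * ?\<theta>) - restrict_vars {v} (p - c F * ?\<theta>)"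
      by (simp only: \<rho>.hom_diff)
    also have "\<dots> = 0"
      using c_vertex F by simp
    finally have zero: "restrict_vars {v} (?\<theta> * (c F - c F')) = 0" .
    have "restrict_vars {v} vertex_sum = mpoly_var v"
      using restrict_vertex_sum[of "{v}"] vertex_face[of v] F by auto
    from vertex_nonzerodivisor[OF f this zero] have "restrict_vars {v} (c F - c F') = 0" .
    then show ?thesis
      by (simp add: \<rho>.hom_diff)
  qed
  obtain c' where c': "\<forall>F\<in>\<Delta>. card F = 2 \<longrightarrow> restrict_vars F c' = restrict_vars F (c F)"
    using glue[of c, OF d agree] by blast
  have "restrict_vars F (p - c' * ?\<theta>) = 0" if F: "F \<in> \<Delta>" "card F = d" for F
  proof -
    interpret \<rho>: ring_morphism "restrict_vars F"
      by (rule restrict_vars_morphism)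
    show ?thesis
      using c[of F] c' F d by (simp add: \<rho>.hom_diff \<rho>.hom_mult)
  qed
  then show ?thesis
    by (auto simp: nonface_ideal_iff)
qed

lemma regular_sequence_in_maximal:
  fixes M :: "('a, 'k::field) mpoly set"
  assumes M: "is_maximal M" "nonface_ideal \<Delta> \<subseteq> M"
  shows "\<exists>xs. length xs = d \<and> set xs \<subseteq> M \<and> regular_modulo (nonface_ideal \<Delta>) xs"
proof (cases "d = 0")
  case True
  then show ?thesis
    by (intro exI[of _ "[]"]) (simp add: regular_modulo_def)
next
  case False
  define N where "N = (nonface_ideal \<Delta> :: ('a, 'k) mpoly set)"
  have N: "is_ideal N"
    unfolding N_def by (rule nonface_ideal_ideal)
  have Mi: "is_ideal M"
    using M by (simp add: is_maximal_def)
  \<comment> \<open>Purity extends the face of variables nonzero modulo \<open>M\<close> to size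
    \<open>d\<close>, with the same \<open>d\<close> for every \<open>M\<close>.\<close>
  obtain F where F: "F \<in> \<Delta>" "{v. mpoly_var v \<notin> M} \<subseteq> F" "card F = d"
    using pure[OF nonzero_variables_face[OF M]] by blast
  have var: "mpoly_var v \<in> M" if "v \<notin> F" for v
    using F(2) that by blast
  obtain f where f: "f \<noteq> 0" "ceval vertex_sum f \<in> M"
    using vertex_sum_algebraic[OF M(1) F(1,3) False var] by metis
  let ?\<theta> = "ceval vertex_sum f"
  have \<theta>: "a \<in> N" if "?\<theta> * a \<in> N" for a
    using vertex_sum_regular[OF f(1) False] that unfolding N_def by blast
  show ?thesis
  proof (cases "d = 1")
    case True
    have "regular_modulo N [?\<theta>]"
      using \<theta> by (simp add: regular_modulo_def ideal_hull_eq[OF N])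
    then show ?thesis
      using True f(2) unfolding N_def by (intro exI[of _ "[?\<theta>]"]) simp
  next
    case d1: False
    then have d: "d = 2"
      using False d_le by simp
    obtain u w where uw: "F = {u, w}" "u \<noteq> w"
      using F(3) d by (auto simp: card_2_iff)
    \<comment> \<open>\<open>x_w\<close> is the image of the inner variable, the one in which
      Zariski's lemma provides a polynomial.\<close>
    have "\<exists>q. mpoly_var v - bieval (mpoly_var w) (mpoly_var u) q \<in> M" for v
    proof -
      interpret ring_morphism "bieval (mpoly_var w) (mpoly_var u)"
        by (rule bieval_morphism)
      consider "v = u" | "v = w" | "v \<notin> F"
        using uw by blast
      then show ?thesis
      proof cases
        case 1
        then show ?thesis
          using ideal_zero[OF Mi] by (intro exI[of _ "[:0, 1:]"]) (simp add: bieval_Y)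
      next
        case 2
        then show ?thesis
          using ideal_zero[OF Mi] by (intro exI[of _ "[:[:0, 1:]:]"]) (simp add: bieval_X)
      next
        case 3
        then show ?thesis
          using var by (intro exI[of _ 0]) (simp add: hom_zero)
      qed
    qed
    then obtain g where g: "g \<noteq> 0" "ceval (mpoly_var w) g \<in> M"
      using algebraic_modulo_maximal[OF M(1)] by metis
    \<comment> \<open>At a vertex \<open>v\<close> of an edge this becomes
      \<open>g(x_v) * g(0)\<close>, whichever edge was taken.\<close>
    define c where "c F = (\<Prod>v\<in>F. ceval (mpoly_var v :: ('a, 'k) mpoly) g)" for F
    have c_vertex: "restrict_vars {v} (c F) = ceval (mpoly_var v) g * ceval 0 g"
      if v: "card F = 2" "v \<in> F" for F v
    proof -
      obtain w where w: "F = {v, w}" "v \<noteq> w"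
        using v by (auto simp: card_2_iff doubleton_eq_iff)
      interpret \<rho>: ring_morphism "restrict_vars {v}"
        by (rule restrict_vars_morphism)
      show ?thesis
        using w by (simp add: c_def \<rho>.hom_mult restrict_vars_ceval restrict_vars_var)
    qed
    obtain G where "\<forall>F\<in>\<Delta>. card F = 2 \<longrightarrow> restrict_vars F G = restrict_vars F (c F)"
      using glue[OF d, of c] c_vertex by auto
    moreover have "restrict_vars F (c F) = c F" for F
      by (simp add: c_def ring_morphism.hom_prod[OF restrict_vars_morphism] restrict_vars_ceval restrict_vars_var)
    ultimately have G: "\<And>F. F \<in> \<Delta> \<Longrightarrow> card F = 2 \<Longrightarrow> restrict_vars F G = c F"
      by simp
    \<comment> \<open>\<open>g(x_w)\<close> is a factor of \<open>c F\<close>, and \<open>G\<close>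
      is congruent to \<open>c F\<close> because only the variables of \<open>F\<close> survive
      modulo \<open>M\<close>.\<close>
    have "c F \<in> M"
      using uw g(2) ideal_mult[OF Mi] by (simp add: c_def)
    moreover have "G - c F \<in> M"
      using restrict_vars_congruent[of M F G, OF Mi var] G[OF F(1)] F(3) d by simp
    ultimately have "G \<in> M"
      using ideal_diff_cancel[OF Mi] by blast
    have "\<exists>c. a - c * ?\<theta> \<in> N" if "G * a - q * ?\<theta> \<in> N" for a q
      using regular_pair_second[OF d f(1) g(1) G[unfolded c_def]] that unfolding N_def by blast
    then have "regular_modulo N [?\<theta>, G]"
      using \<theta> by (auto simp: regular_modulo_def less_Suc_eq ideal_hull_insert ideal_hull_eq[OF N])
    then show ?thesis
      using d f(2) \<open>G \<in> M\<close> unfolding N_def by (intro exI[of _ "[?\<theta>, G]"]) simp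
  qed
qed

theorem cohen_macaulay: "cohen_macaulay_complex TYPE('k::field) \<Delta>"
proof (rule cohen_macaulay_complexI[where d = d])
  fix J :: "('a, 'k) mpoly set"
  assume "is_ideal J" "nonface_ideal \<Delta> \<subseteq> J"
  then show "\<exists>B. finite B \<and> J = ideal_hull (B \<union> nonface_ideal \<Delta>)"
    using dim d_le by (intro nonface_ideal_noetherian) (auto intro: order_trans)
next
  fix Q :: "nat \<Rightarrow> ('a, 'k) mpoly set"
  assume "\<And>i. i \<le> Suc d \<Longrightarrow> is_prime (Q i)" "\<And>i. i \<le> d \<Longrightarrow> Q i \<subset> Q (Suc i)" "nonface_ideal \<Delta> \<subseteq> Q 0"
  then show False
    using no_long_prime_chain[OF dim, where Q = Q] by blast
qed (rule regular_sequence_in_maximal)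

end

section \<open>Links in the total complex\<close>

lemma total_complex_iff: "F \<in> total_complex V E \<longleftrightarrow> (\<exists>S\<in>total_indices V E. F \<subseteq> S)"
  by (simp add: total_complex_def)

locale nontrivial_connected_graph =
  fixes V :: "'a set" and E :: "'a set set"
  assumes graph: "simple_graph V E" and connected: "connected_graph V E" and nonempty: "E \<noteq> {}"
begin

lemma edge_card: "e \<in> E \<Longrightarrow> card e = 2" and edge_subset: "e \<in> E \<Longrightarrow> e \<subseteq> V" and finite_V: "finite V"
  using graph by (auto simp: simple_graph_def)

lemma edge_eq: "e \<in> E \<Longrightarrow> p \<in> e \<Longrightarrow> \<exists>q. e = {p, q} \<and> p \<noteq> q"
  using edge_card[of e] by (auto simp: card_2_iff)

lemma finite_E: "finite E"
  using edge_subset finite_V by (meson Pow_iff finite_Pow_iff finite_subset subsetI)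

text \<open>A path from \<open>p\<close> to an endpoint of some edge starts with an edge at
  \<open>p\<close>, unless \<open>p\<close> is that endpoint. Thus the singleton indices disappear
  and all facets have three elements.\<close>

lemma not_isolated: "\<not> isolated_vertex V E p"
proof
  assume p: "isolated_vertex V E p"
  obtain e where e: "e \<in> E"
    using nonempty by blast
  then obtain a where a: "a \<in> e" "a \<in> V"
    using edge_card[OF e] edge_subset[OF e] by (auto simp: card_2_iff)
  then have "(p, a) \<in> {(x, y). {x, y} \<in> E}\<^sup>*"
    using p connected by (auto simp: connected_graph_def isolated_vertex_def)
  then show False
    by (cases rule: converse_rtranclE) (use p a e in \<open>auto simp: isolated_vertex_def\<close>)
qed

lemma incident_edge: "p \<in> V \<Longrightarrow> \<exists>e\<in>E. p \<in> e"
  using not_isolated by (auto simp: isolated_vertex_def)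

lemma total_index_card: "S \<in> total_indices V E \<Longrightarrow> finite S \<and> card S = 3"
  unfolding total_indices_def adjacent_vertices_def adjacent_edges_def
  by (elim UnE CollectE exE conjE) (simp_all add: not_isolated)

lemma total_index_subset: "S \<in> total_indices V E \<Longrightarrow> S \<subseteq> Inl ` V \<union> Inr ` E"
  using edge_subset not_isolated
  by (auto simp: total_indices_def adjacent_vertices_def adjacent_edges_def)

lemma vertex_vertex_edge:
  "\<lbrakk>{p, q} \<in> E; p \<noteq> q; e \<in> E; p \<in> e \<or> q \<in> e\<rbrakk> \<Longrightarrow> {Inl p, Inl q, Inr e} \<in> total_indices V E"
  unfolding total_indices_def adjacent_vertices_def by blast

lemma edge_edge_vertex:
  "\<lbrakk>e \<in> E; f \<in> E; e \<noteq> f; e \<inter> f \<noteq> {}; r \<in> e \<or> r \<in> f\<rbrakk> \<Longrightarrow> {Inr e, Inr f, Inl r} \<in> total_indices V E"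
proof -
  assume *: "e \<in> E" "f \<in> E" "e \<noteq> f" "e \<inter> f \<noteq> {}" "r \<in> e \<or> r \<in> f"
  then have "adjacent_edges E e f" "r \<in> V"
    using edge_subset by (auto simp: adjacent_edges_def)
  then show ?thesis
    using *(5) unfolding total_indices_def by blast
qed

lemma finite_total_complex: "finite (total_complex V E)"
proof (rule finite_subset)
  show "total_complex V E \<subseteq> Pow (Inl ` V \<union> Inr ` E)"
  proof
    fix F assume "F \<in> total_complex V E"
    then obtain S where "S \<in> total_indices V E" "F \<subseteq> S"
      by (auto simp: total_complex_iff)
    then show "F \<in> Pow (Inl ` V \<union> Inr ` E)"
      using total_index_subset[of S] by blast
  qed
qed (use finite_V finite_E in auto)

lemma total_face: "F \<in> total_complex V E \<Longrightarrow> finite F \<and> card F \<le> 3"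
  unfolding total_complex_iff using total_index_card by (metis card_mono finite_subset)

lemma total_index_face: "S \<in> total_indices V E \<Longrightarrow> F \<subseteq> S \<Longrightarrow> F \<in> total_complex V E"
  by (auto simp: total_complex_iff)

lemma pure_total_complex: "pure_complex (total_complex V E)"
proof -
  have "card F = 3" if F: "F \<in> facets (total_complex V E)" for F
  proof -
    obtain S where S: "S \<in> total_indices V E" "F \<subseteq> S"
      using F by (auto simp: facets_def total_complex_iff)
    then have "S = F"
      using F total_index_face[OF S(1)] by (auto simp: facets_def)
    then show ?thesis
      using total_index_card[OF S(1)] by simp
  qed
  then show ?thesis
    by (simp add: pure_complex_def)
qed

section \<open>Connectedness of the links of vertices\<close>

definition link_step :: "'a + 'a set \<Rightarrow> (('a + 'a set) \<times> ('a + 'a set)) set" where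
  "link_step z = {(x, y). {x, y} \<in> link (total_complex V E) {z}}"

lemma link_stepI:
  assumes "S \<in> total_indices V E" "{x, y, z} \<subseteq> S" "x \<noteq> z" "y \<noteq> z"
  shows "(x, y) \<in> link_step z"
proof -
  have "{x, y} \<in> total_complex V E" "insert z {x, y} \<in> total_complex V E"
    using total_index_face[OF assms(1)] assms(2) by auto
  then show ?thesis
    using assms by (auto simp: link_step_def link_def insert_commute)
qed

lemma link_vertexE:
  assumes "y \<in> \<Union>(link (total_complex V E) {z})"
  obtains S where "S \<in> total_indices V E" "y \<in> S" "z \<in> S" "y \<noteq> z"
  using assms by (fastforce simp: link_def total_complex_iff)

text \<open>A fixed edge \<open>e0\<close> at \<open>p\<close> serves as hub. A neighbour
  \<open>q\<close> forms a face with \<open>p\<close> and \<open>e0\<close>, and an edge meeting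
  \<open>p\<close> or \<open>q\<close> forms a face with \<open>p\<close> and
  \<open>q\<close>.\<close>

lemma vertex_link_connected:
  assumes e0: "e0 \<in> E" "p \<in> e0" and y: "y \<in> \<Union>(link (total_complex V E) {Inl p})"
  shows "(y, Inr e0) \<in> (link_step (Inl p))\<^sup>*"
proof -
  have vertex: "(Inl q, Inr e0) \<in> (link_step (Inl p))\<^sup>*" if "{p, q} \<in> E" "p \<noteq> q" for q
    by (rule r_into_rtrancl, rule link_stepI[OF vertex_vertex_edge[OF that e0(1)]])
      (use that e0 in auto)
  have edge: "(Inr f, Inr e0) \<in> (link_step (Inl p))\<^sup>*"
    if "{p, q} \<in> E" "p \<noteq> q" "f \<in> E" "p \<in> f \<or> q \<in> f" for f q
  proof -
    have "(Inr f, Inl q) \<in> link_step (Inl p)"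
      by (rule link_stepI[OF vertex_vertex_edge[OF that]]) (use that in auto)
    then show ?thesis
      using vertex[OF that(1,2)] by (rule converse_rtrancl_into_rtrancl)
  qed
  obtain S where S: "S \<in> total_indices V E" "y \<in> S" "Inl p \<in> S" "y \<noteq> Inl p"
    using y by (rule link_vertexE)
  show ?thesis
  proof (cases y)
    case (Inl q)
    then have "{p, q} \<in> E" "p \<noteq> q"
      using S not_isolated
      by (auto simp: total_indices_def adjacent_vertices_def insert_commute)
    then show ?thesis
      using vertex Inl by simp
  next
    case (Inr f)
    have "f \<in> E"
      using S total_index_subset Inr by blast
    \<comment> \<open>If \<open>f\<close> avoids \<open>p\<close>, the common face contributes
      either a neighbour of \<open>p\<close> on \<open>f\<close> or an edge at \<open>p\<close>
      meeting \<open>f\<close>, whose other end is such a neighbour.\<close>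
    moreover have "\<exists>q. {p, q} \<in> E \<and> p \<noteq> q \<and> (p \<in> f \<or> q \<in> f)"
    proof (cases "p \<in> f")
      case True
      then show ?thesis
        using edge_eq[OF \<open>f \<in> E\<close>] \<open>f \<in> E\<close> by blast
    next
      case False
      consider q where "{p, q} \<in> E" "p \<noteq> q" "q \<in> f" | g where "g \<in> E" "p \<in> g" "f \<inter> g \<noteq> {}"
        using S Inr False not_isolated
        by (auto simp: total_indices_def adjacent_vertices_def adjacent_edges_def insert_commute)
      then show ?thesis
      proof cases
        case 2
        then obtain q where "g = {p, q}" "p \<noteq> q"
          using edge_eq by blast
        then show ?thesis
          using 2 False by blast
      qed blast
    qed
    ultimately show ?thesis
      using edge Inr by blast
  qed
qed

text \<open>The endpoint \<open>a\<close> serves as hub. It forms a face with the edge and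
  \<open>b\<close>, and with the edge and any adjacent edge; another vertex of the link is adjacent
  to \<open>a\<close> or \<open>b\<close>, or lies on an adjacent edge.\<close>

lemma edge_link_connected:
  assumes e: "{a, b} \<in> E" "a \<noteq> b" and y: "y \<in> \<Union>(link (total_complex V E) {Inr {a, b}})"
  shows "(y, Inl a) \<in> (link_step (Inr {a, b}))\<^sup>*"
proof -
  let ?z = "Inr {a, b} :: 'a + 'a set"
  have base: "(Inl b, Inl a) \<in> (link_step ?z)\<^sup>*"
    by (rule r_into_rtrancl, rule link_stepI[OF vertex_vertex_edge[OF e e(1)]]) auto
  have adjacent_edge: "(Inr f, Inl a) \<in> link_step ?z"
    if "f \<in> E" "f \<noteq> {a, b}" "{a, b} \<inter> f \<noteq> {}" for f
    by (rule link_stepI[OF edge_edge_vertex[OF e(1) that(1), of a]]) (use that in auto)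
  have end_vertex: "(Inl q, Inl a) \<in> (link_step ?z)\<^sup>*" if "q \<in> {a, b}" for q
    using that base by auto
  obtain S where S: "S \<in> total_indices V E" "y \<in> S" "?z \<in> S" "y \<noteq> ?z"
    using y by (rule link_vertexE)
  show ?thesis
  proof (cases y)
    case (Inl q)
    show ?thesis
    proof (cases "q \<in> {a, b}")
      case False
      then consider r where "{r, q} \<in> E" "r \<noteq> q" "r \<in> {a, b}"
        | f where "f \<in> E" "f \<noteq> {a, b}" "{a, b} \<inter> f \<noteq> {}" "q \<in> f"
        using S Inl not_isolated
        by (auto simp: total_indices_def adjacent_vertices_def adjacent_edges_def insert_commute)
      then show ?thesis
      proof cases
        case 1
        have "(Inl q, Inl r) \<in> link_step ?z"
          by (rule link_stepI[OF vertex_vertex_edge[OF 1(1,2) e(1)]]) (use 1 in auto)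
        then show ?thesis
          using end_vertex[OF 1(3)] Inl by (auto intro: converse_rtrancl_into_rtrancl)
      next
        case 2
        have "(Inl q, Inr f) \<in> link_step ?z"
          by (rule link_stepI[OF edge_edge_vertex[OF e(1) 2(1), of q]]) (use 2 in auto)
        then show ?thesis
          using adjacent_edge[OF 2(1,2,3)] Inl by (auto intro: converse_rtrancl_into_rtrancl)
      qed
    qed (use end_vertex Inl in simp)
  next
    case (Inr f)
    have f: "f \<in> E"
      using S total_index_subset Inr by blast
    have "f \<noteq> {a, b}" "{a, b} \<inter> f \<noteq> {}"
      using S Inr by (auto simp: total_indices_def adjacent_edges_def)
    then show ?thesis
      using adjacent_edge[OF f] Inr by auto
  qed
qed

lemma link_connected:
  assumes x: "x \<in> \<Union>(link (total_complex V E) {z})" and y: "y \<in> \<Union>(link (total_complex V E) {z})"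
  shows "(x, y) \<in> (link_step z)\<^sup>*"
proof -
  have "sym (link_step z)"
    by (auto simp: sym_def link_step_def insert_commute)
  then have sym: "sym ((link_step z)\<^sup>*)"
    by (rule sym_rtrancl)
  have "\<exists>c. \<forall>y\<in>\<Union>(link (total_complex V E) {z}). (y, c) \<in> (link_step z)\<^sup>*"
  proof -
    obtain S where "S \<in> total_indices V E" "z \<in> S"
      using link_vertexE[OF x] by metis
    then have "z \<in> Inl ` V \<union> Inr ` E"
      using total_index_subset by blast
    then consider p where "z = Inl p" "p \<in> V" | e where "z = Inr e" "e \<in> E"
      by blast
    then show ?thesis
    proof cases
      case 1
      then show ?thesis
        using incident_edge[of p] vertex_link_connected by blast
    next
      case 2
      then obtain a b where "e = {a, b}" "a \<noteq> b"
        using edge_card[of e] by (auto simp: card_2_iff)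
      then show ?thesis
        using 2 edge_link_connected by blast
    qed
  qed
  then obtain c where "(x, c) \<in> (link_step z)\<^sup>*" "(y, c) \<in> (link_step z)\<^sup>*"
    using x y by blast
  then show ?thesis
    using sym by (meson rtrancl_trans symD)
qed

text \<open>Removing \<open>\<sigma>\<close> from a three-element facet leaves
  \<open>3 - card \<sigma>\<close> elements. This is 2 only for a singleton \<open>\<sigma>\<close>,
  the case in which connectedness was shown.\<close>

lemma link_cohen_macaulay:
  assumes \<sigma>: "\<sigma> \<in> total_complex V E" "\<sigma> \<noteq> {}"
  shows "cohen_macaulay_complex TYPE('k::field) (link (total_complex V E) \<sigma>)"
proof -
  let ?L = "link (total_complex V E) \<sigma>"
  have fin: "finite \<sigma>" "card \<sigma> \<le> 3"
    using total_face[OF \<sigma>(1)] by auto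
  then have pos: "card \<sigma> > 0"
    using \<sigma>(2) by (simp add: card_gt_0_iff)
  interpret connected_low_dim_complex ?L "3 - card \<sigma>"
  proof
    show "finite ?L"
      using finite_total_complex by (rule rev_finite_subset) (auto simp: link_def)
    show "finite F" if "F \<in> ?L" for F
      using that total_face by (auto simp: link_def)
    show "G \<in> ?L" if "F \<in> ?L" "G \<subseteq> F" for F G
      using that unfolding link_def total_complex_iff by blast
  next
    fix F assume "F \<in> ?L"
    then obtain S where S: "S \<in> total_indices V E" "F \<union> \<sigma> \<subseteq> S" "F \<inter> \<sigma> = {}"
      by (auto simp: link_def total_complex_iff)
    then have "S - \<sigma> \<in> ?L"
      by (auto simp: link_def Un_absorb2 intro!: total_index_face[OF S(1)])
    moreover have card: "card (S - \<sigma>) = 3 - card \<sigma>"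
      using S total_index_card[OF S(1)] fin by (simp add: card_Diff_subset)
    moreover have "F \<subseteq> S - \<sigma>"
      using S by blast
    ultimately show "\<exists>F'\<in>?L. F \<subseteq> F' \<and> card F' = 3 - card \<sigma>"
      by blast
    show "card F \<le> 3 - card \<sigma>"
      using \<open>F \<subseteq> S - \<sigma>\<close> total_index_card[OF S(1)] unfolding card[symmetric] by (intro card_mono) auto
  next
    show "3 - card \<sigma> \<le> 2"
      using pos by linarith
  next
    fix u v assume "3 - card \<sigma> = 2" and uv: "u \<in> \<Union>?L" "v \<in> \<Union>?L"
    then have "card \<sigma> = 1"
      by linarith
    then obtain z where "\<sigma> = {z}"
      by (rule card_1_singletonE)
    then show "(u, v) \<in> {(x, y). {x, y} \<in> ?L}\<^sup>*"
      using link_connected uv by (simp add: link_step_def)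
  qed
  show ?thesis
    by (rule cohen_macaulay)
qed

lemma buchsbaum_total_complex: "buchsbaum TYPE('k::field) (total_complex V E)"
  using pure_total_complex link_cohen_macaulay by (auto simp: buchsbaum_def)

end

text \<open>A connected graph without edges is a point. Its facet is a singleton index, so it falls
  outside the count of three, and the only link is \<open>{{}}\<close>.\<close>

lemma buchsbaum_single_vertex:
  assumes "connected_graph V {}"
  shows "buchsbaum TYPE('k::field) (total_complex V {})"
proof -
  obtain p where p: "p \<in> V"
    using assms by (auto simp: connected_graph_def)
  have "v = p" if "v \<in> V" for v
    using assms p that by (auto simp: connected_graph_def)
  then have "V = {p}"
    using p by blast
  then have "total_indices V {} = {{Inl p}}"
    by (auto simp: total_indices_def adjacent_vertices_def adjacent_edges_def isolated_vertex_def)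
  then have T: "total_complex V {} = {{}, {Inl p}}"
    by (auto simp: total_complex_def)
  have link: "link {{}, {Inl p}} {Inl p} = ({{}} :: ('a + 'a set) set set)"
    by (auto simp: link_def)
  interpret connected_low_dim_complex "{{}} :: ('a + 'a set) set set" 0
    by standard auto
  have "pure_complex (total_complex V {})"
    by (auto simp: T pure_complex_def facets_def)
  moreover have "cohen_macaulay_complex TYPE('k) (link (total_complex V {}) {Inl p})"
    unfolding T link by (rule cohen_macaulay)
  ultimately show ?thesis
    by (auto simp: buchsbaum_def T)
qed

theorem theorem3p3:
  fixes V :: "'a set" and E :: "'a set set"
  assumes "simple_graph V E" and "connected_graph V E"
  shows "buchsbaum TYPE('k::field) (total_complex V E)"
proof (cases "E = {}")
  case True
  then show ?thesis
    using buchsbaum_single_vertex assms(2) by simp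
next
  case False
  then interpret nontrivial_connected_graph V E
    using assms by unfold_locales
  show ?thesis
    by (rule buchsbaum_total_complex)
qed

end
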